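(* Let $G$ be a finite group with $\operatorname{Irr}(G)=\{\chi_1,\ldots,\chi_r\}$ (distinct characters), let $K$ be a field, and let $R_G=K[u_1,\ldots,u_p]\subset K[x_1,\ldots,x_r]$, where $u_1,\ldots,u_p$ are the monomials corresponding to the elements of the Hilbert basis of $M(G)$. The following are equivalent: (1) $G$ is almost monomial. (2) For any $j\neq k$ in $\{1,\ldots,r\}$, there exists $i\in\{1,\ldots,p\}$ such that $x_j\mid u_i$ and $x_k\nmid u_i$. (3) For any $k\in\{1,\ldots,r\}$, there exists a subset $I_k\subset\{1,2,\ldots,p\}$ such that $\operatorname{supp}\big(\prod_{i\in I_k}u_i\big)=\{x_1,\ldots,x_{k-1},x_{k+1},\ldots,x_r\}$.
   Context: Characters are complex characters of finite groups; $\operatorname{Irr}(G)$ is the set of irreducible ones. $\operatorname{Ch}(G)=\{a_1\chi_1+\cdots+a_r\chi_r : a_i\in\mathbb{N}\}$ (including $0$) is the additive monoid of characters together with $0$, isomorphic to $\mathbb{N}^r$. A character of $G$ is monomial if it equals $\lambda^G$ for some subgroup $H\leqslant G$ and some linear (degree one) character $\lambda$ of $H$, where $\lambda^G$ denotes the induced character. $M(G)$ is the submonoid of $\operatorname{Ch}(G)$ generated by the monomial characters; its Hilbert basis is its unique minimal system of generators $\{\sigma_1,\ldots,\sigma_p\}$. Writing $\sigma_i=\sum_{j=1}^r a_{ij}\chi_j$, put $u_i=\prod_{j=1}^r x_j^{a_{ij}}$; then $R_G=K[M(G)]:=K[u_1,\ldots,u_p]\subset K[x_1,\ldots,x_r]$.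 A finite group $G$ is almost monomial if for every two distinct $\chi\neq\psi\in\operatorname{Irr}(G)$ there exist a subgroup $H$ of $G$ and a linear character $\lambda$ of $H$ such that $\chi$ is a constituent of $\lambda^G$ and $\psi$ is not a constituent of $\lambda^G$. For a monomial $u$, $\operatorname{supp}(u)=\{x_i : x_i\mid u\}$; an empty product is $1$. *)

theory Defs
  imports
    "HOL-Library.Poly_Mapping"
    "Jordan_Normal_Form.VS_Connect"
begin

section \<open>Complex representations and characters of finite groups\<close>

definition mat_trace :: "'a::comm_monoid_add mat \<Rightarrow> 'a" where
  "mat_trace A = (\<Sum>i<dim_row A. A $$ (i, i))"

definition representation :: "('g, 'm) monoid_scheme \<Rightarrow> nat \<Rightarrow> ('g \<Rightarrow> complex mat) \<Rightarrow> bool" where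
  "representation G n \<rho> \<longleftrightarrow> \<rho> \<in> hom G (units_of (ring_mat TYPE(complex) n ()))"

definition irreducible_representation ::
    "('g, 'm) monoid_scheme \<Rightarrow> nat \<Rightarrow> ('g \<Rightarrow> complex mat) \<Rightarrow> bool" where
  "irreducible_representation G n \<rho> \<longleftrightarrow>
     representation G n \<rho> \<and> n > 0 \<and>
     (\<forall>W. subspace class_ring W (module_vec TYPE(complex) n) \<and>
          (\<forall>g \<in> carrier G. \<forall>w \<in> W. \<rho> g *\<^sub>v w \<in> W)
        \<longrightarrow> W = {0\<^sub>v n} \<or> W = carrier_vec n)"

text \<open>Functions on a group are extended by 0 off the carrier, so that two characters are equal
  as HOL functions iff they agree on the group.\<close>

definition rep_character :: "('g, 'm) monoid_scheme \<Rightarrow> ('g \<Rightarrow> complex mat) \<Rightarrow> 'g \<Rightarrow> complex" where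
  "rep_character G \<rho> = (\<lambda>g. if g \<in> carrier G then mat_trace (\<rho> g) else 0)"

definition Irr :: "('g, 'm) monoid_scheme \<Rightarrow> ('g \<Rightarrow> complex) set" where
  "Irr G = {rep_character G \<rho> | n \<rho>. irreducible_representation G n \<rho>}"

definition linear_characters :: "('g, 'm) monoid_scheme \<Rightarrow> ('g \<Rightarrow> complex) set" where
  "linear_characters G = {rep_character G \<rho> | \<rho>. representation G 1 \<rho>}"

definition induced_character ::
    "('g, 'm) monoid_scheme \<Rightarrow> 'g set \<Rightarrow> ('g \<Rightarrow> complex) \<Rightarrow> 'g \<Rightarrow> complex" where
  "induced_character G H \<mu> = (\<lambda>g. if g \<in> carrier G then
     (\<Sum>x \<in> carrier G. if x \<otimes>\<^bsub>G\<^esub> g \<otimes>\<^bsub>G\<^esub> inv\<^bsub>G\<^esub> x \<in> H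
                      then \<mu> (x \<otimes>\<^bsub>G\<^esub> g \<otimes>\<^bsub>G\<^esub> inv\<^bsub>G\<^esub> x) else 0) / of_nat (card H)
     else 0)"

definition irr_combination ::
    "('g, 'm) monoid_scheme \<Rightarrow> (('g \<Rightarrow> complex) \<Rightarrow> nat) \<Rightarrow> 'g \<Rightarrow> complex" where
  "irr_combination G a = (\<lambda>g. \<Sum>\<chi> \<in> Irr G. of_nat (a \<chi>) * \<chi> g)"

text \<open>The range of \<open>irr_combination G\<close> is the monoid Ch(G) of characters together with 0.
  Irreducible characters are linearly independent, so the coefficients of an element of Ch(G) at
  the irreducible characters are unique and the description below is meaningful there.\<close>

definition irr_coeff ::
    "('g, 'm) monoid_scheme \<Rightarrow> ('g \<Rightarrow> complex) \<Rightarrow> ('g \<Rightarrow> complex) \<Rightarrow> nat" where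
  "irr_coeff G \<theta> \<chi> = (THE m. \<exists>a. \<theta> = irr_combination G a \<and> a \<chi> = m)"

definition constituent ::
    "('g, 'm) monoid_scheme \<Rightarrow> ('g \<Rightarrow> complex) \<Rightarrow> ('g \<Rightarrow> complex) \<Rightarrow> bool" where
  "constituent G \<chi> \<theta> \<longleftrightarrow> \<chi> \<in> Irr G \<and> (\<exists>a. \<theta> = irr_combination G a \<and> a \<chi> > 0)"

definition almost_monomial :: "('g, 'm) monoid_scheme \<Rightarrow> bool" where
  "almost_monomial G \<longleftrightarrow>
     (\<forall>\<chi> \<in> Irr G. \<forall>\<psi> \<in> Irr G. \<chi> \<noteq> \<psi> \<longrightarrow>
        (\<exists>H \<mu>. subgroup H G \<and> \<mu> \<in> linear_characters (G\<lparr>carrier := H\<rparr>) \<and>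
           constituent G \<chi> (induced_character G H \<mu>) \<and>
           \<not> constituent G \<psi> (induced_character G H \<mu>)))"

section \<open>The monoid generated by the monomial characters\<close>

definition monomial_characters :: "('g, 'm) monoid_scheme \<Rightarrow> ('g \<Rightarrow> complex) set" where
  "monomial_characters G = {induced_character G H \<mu> | H \<mu>.
     subgroup H G \<and> \<mu> \<in> linear_characters (G\<lparr>carrier := H\<rparr>)}"

inductive_set generated_submonoid :: "('g \<Rightarrow> complex) set \<Rightarrow> ('g \<Rightarrow> complex) set"
  for B :: "('g \<Rightarrow> complex) set" where
  zero: "(\<lambda>_. 0) \<in> generated_submonoid B"
| base: "\<theta> \<in> B \<Longrightarrow> \<theta> \<in> generated_submonoid B"
| add: "\<theta> \<in> generated_submonoid B \<Longrightarrow> \<eta> \<in> generated_submonoid B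
        \<Longrightarrow> (\<lambda>g. \<theta> g + \<eta> g) \<in> generated_submonoid B"

definition monomial_monoid :: "('g, 'm) monoid_scheme \<Rightarrow> ('g \<Rightarrow> complex) set" where
  "monomial_monoid G = generated_submonoid (monomial_characters G)"

definition is_hilbert_basis :: "('g \<Rightarrow> complex) set \<Rightarrow> ('g \<Rightarrow> complex) set \<Rightarrow> bool" where
  "is_hilbert_basis M B \<longleftrightarrow>
     generated_submonoid B = M \<and> (\<forall>C. C \<subset> B \<longrightarrow> generated_submonoid C \<noteq> M)"

section \<open>Monomials and monomial algebras\<close>

text \<open>Polynomials are finitely supported maps from exponent vectors to coefficients. The variables
  are indexed by all of \<open>nat\<close>; the polynomial ring in the variables 1 to r is the subring of those
  polynomials in which no other variable occurs. For the monomials below it makes no difference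
  whether divisibility is taken in that subring or in the whole type.\<close>

type_synonym 'k mpoly = "(nat \<Rightarrow>\<^sub>0 nat) \<Rightarrow>\<^sub>0 'k"

definition Var :: "nat \<Rightarrow> 'k::field mpoly" where
  "Var j = Poly_Mapping.single (Poly_Mapping.single j 1) 1"

inductive_set generated_algebra :: "'k::field mpoly set \<Rightarrow> 'k mpoly set"
  for U :: "'k mpoly set" where
  const: "Poly_Mapping.single 0 c \<in> generated_algebra U"
| base: "u \<in> U \<Longrightarrow> u \<in> generated_algebra U"
| add: "p \<in> generated_algebra U \<Longrightarrow> q \<in> generated_algebra U \<Longrightarrow> p + q \<in> generated_algebra U"
| mult: "p \<in> generated_algebra U \<Longrightarrow> q \<in> generated_algebra U \<Longrightarrow> p * q \<in> generated_algebra U"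

definition character_monomial ::
    "('g, 'm) monoid_scheme \<Rightarrow> nat \<Rightarrow> (nat \<Rightarrow> 'g \<Rightarrow> complex) \<Rightarrow> ('g \<Rightarrow> complex) \<Rightarrow> 'k::field mpoly" where
  "character_monomial G r \<chi> \<theta> = (\<Prod>j\<in>{1..r}. Var j ^ irr_coeff G \<theta> (\<chi> j))"

definition supp :: "nat \<Rightarrow> 'k::field mpoly \<Rightarrow> 'k mpoly set" where
  "supp r u = {Var j | j. j \<in> {1..r} \<and> Var j dvd u}"

end

theory Submission
  imports Defs "Jordan_Normal_Form.Spectral_Radius"
begin

text \<open>Conditions (2) and (3) are both equivalent to: for \<open>j \<noteq> k\<close> some Hilbert basis element contains
  \<open>\<chi>\<^sub>j\<close> and not \<open>\<chi>\<^sub>k\<close>; for (3) take \<open>I\<^sub>k\<close> to be the set of all \<open>i\<close> with \<open>x\<^sub>k\<close> not dividing \<open>u\<^sub>i\<close>.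
  Coefficients are nonnegative, so if a sum of characters contains \<open>\<chi>\<^sub>j\<close> and not \<open>\<chi>\<^sub>k\<close>, then so does
  one of its summands. Hence it makes no difference whether the separating character is sought in
  the Hilbert basis, in the whole monoid, or among the monomial characters. Coefficients are
  meaningful because every character is an \<open>\<nat>\<close>-combination of irreducible ones (composition
  factors) and because irreducible characters are orthogonal (Schur's lemma).\<close>

section \<open>Characters as sums of irreducible characters\<close>

text \<open>\<open>induced_character\<close> is a formula with a division by \<open>card H\<close>,
  and \<open>irr_coeff\<close> is a definite description, so neither is visibly tied to natural
  numbers. Coefficients exist because the induced representation can be written down as matrices and
  any representation can be cut along invariant subspaces. Complete reducibility is avoided: in a
  basis adapted to an invariant subspace the matrices are block triangular, and the trace sees only
  the diagonal blocks. Uniqueness comes from a pairing with \<open>\<psi> (inv g)\<close> in place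
  of the complex conjugate of \<open>\<psi> g\<close>, so no unitary structure enters. Finiteness of
  \<open>Irr G\<close> is read off from the given numbering by \<open>{1..r}\<close>. The basis and
  the monomial characters are compared only through the monoid that both generate; which monomial
  characters are basis elements is never asked.\<close>

lemma subspace_vecI:
  fixes W :: "'a::field vec set"
  assumes "W \<subseteq> carrier_vec n" "0\<^sub>v n \<in> W"
    and "\<And>v w. v \<in> W \<Longrightarrow> w \<in> W \<Longrightarrow> v + w \<in> W"
    and "\<And>c v. v \<in> W \<Longrightarrow> c \<cdot>\<^sub>v v \<in> W"
  shows "VectorSpace.subspace class_ring W (module_vec TYPE('a) n)"
  unfolding VectorSpace.subspace_def submodule_def
  using assms vec_vs vec_module by (auto simp: module_vec_simps)

text \<open>A basis of \<open>W\<close> is extended to a basis of the whole space and written into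
  the columns of \<open>Q\<close>, the vectors of \<open>W\<close> in front. The result is phrased
  with a pair of inverse matrices because it is used to conjugate a representation into block
  form.\<close>

lemma (in vec_space) adapted_basis:
  assumes W: "VectorSpace.subspace class_ring W V"
  obtains d Q R where "d \<le> n" "Q \<in> carrier_mat n n" "R \<in> carrier_mat n n"
    "Q * R = 1\<^sub>m n" "R * Q = 1\<^sub>m n"
    "W = {Q *\<^sub>v c | c. c \<in> carrier_vec n \<and> (\<forall>i. d \<le> i \<and> i < n \<longrightarrow> c $ i = 0)}"
proof -
  have sub: "submodule class_ring W V" using W by simp
  then have Wc: "W \<subseteq> carrier_vec n" by (auto simp: submodule_def module_vec_simps)
  \<comment> \<open>The dimension bounds every independent set, which makes both maximal choices
    below possible.\<close>
  have bnd: "finite A \<and> card A \<le> n" if "A \<subseteq> carrier_vec n \<and> lin_indpt A" for A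
    using li_le_dim[OF fin_dim, of A] that dim_is_n by auto
  have empty: "lin_indpt {}" by (auto simp: lin_dep_def)
  obtain B where B: "maximal B (\<lambda>S. S \<subseteq> W \<and> lin_indpt S)"
    using maximal_exists[of "\<lambda>S. S \<subseteq> W \<and> lin_indpt S" n "{}"] bnd Wc empty by blast
  then have BW: "B \<subseteq> W" and Bli: "lin_indpt B" by (auto simp: maximal_def)
  then have Bc: "B \<subseteq> carrier_vec n" and Bfin: "finite B" using bnd Wc by blast+
  have span_B: "span B = W"
  proof
    show "span B \<subseteq> W" using span_is_subset[OF BW] sub by simp
    show "W \<subseteq> span B"
    proof
      fix w assume w: "w \<in> W"
      show "w \<in> span B"
      proof (rule ccontr)
        assume n: "w \<notin> span B"
        then have wB: "w \<notin> B" using in_own_span[OF Bc] by auto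
        then have "lin_indpt (B \<union> {w})"
          using lin_dep_iff_in_span[OF Bc Bli _ wB] n w Wc by auto
        then show False using B w BW wB unfolding maximal_def by blast
      qed
    qed
  qed
  obtain C where C: "maximal C (\<lambda>S. B \<subseteq> S \<and> S \<subseteq> carrier_vec n \<and> lin_indpt S)"
    using maximal_exists[of "\<lambda>S. B \<subseteq> S \<and> S \<subseteq> carrier_vec n \<and> lin_indpt S" n B] bnd Bc Bli by blast
  then have BC: "B \<subseteq> C" and Cc: "C \<subseteq> carrier_vec n" and Cfin: "finite C"
    using bnd by (auto simp: maximal_def)
  have "maximal C (\<lambda>S. S \<subseteq> carrier_vec n \<and> lin_indpt S)"
    using C unfolding maximal_def by (metis subset_trans)
  then have basis: "basis C" using max_li_is_basis by simp
  then have cardC: "card C = n" using dim_basis Cfin dim_is_n by auto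
  obtain bs where bs: "set bs = B" "distinct bs" using finite_distinct_list[OF Bfin] by blast
  obtain cs where cs: "set cs = C - B" "distinct cs"
    using finite_distinct_list[of "C - B"] Cfin by blast
  \<comment> \<open>The order matters: the first \<open>d\<close> columns span \<open>W\<close>, the
    remaining ones complete the basis.\<close>
  define ws where "ws = bs @ cs"
  have ws: "set ws = C" "distinct ws" using bs cs BC by (auto simp: ws_def)
  have len: "length ws = n" using ws cardC distinct_card by fastforce
  define d where "d = length bs"
  have dn: "d \<le> n" using len by (simp add: d_def ws_def)
  define Q where "Q = mat_of_cols n ws"
  have Q: "Q \<in> carrier_mat n n" using len unfolding Q_def by (metis mat_of_cols_carrier(1))
  have comb: "lincomb a C = Q *\<^sub>v vec n (\<lambda>i. a (ws ! i))" for a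
    using lincomb_as_lincomb_list_distinct[of ws a] lincomb_list_as_mat_mult[of ws "\<lambda>i. a (ws ! i)"]
      ws Cc len carrier_vecD by (fastforce simp: Q_def)
  have surj: "\<exists>c \<in> carrier_vec n. v = Q *\<^sub>v c" if "v \<in> carrier_vec n" for v
  proof -
    have "v \<in> span C" using basis that by (auto simp: basis_def)
    then obtain a where "lincomb a C = v" using finite_in_span[OF Cfin] Cc by auto
    then show ?thesis using comb by (metis vec_carrier)
  qed
  have "\<forall>i. \<exists>c. i < n \<longrightarrow> c \<in> carrier_vec n \<and> unit_vec n i = Q *\<^sub>v c" using surj by (metis unit_vec_carrier)
  then obtain f where f: "\<And>i. i < n \<Longrightarrow> f i \<in> carrier_vec n \<and> unit_vec n i = Q *\<^sub>v f i" by metis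
  \<comment> \<open>Column \<open>i\<close> solves \<open>Q c = unit_vec n i\<close>, so
    \<open>R\<close> is a right inverse; since the matrices are square it is two-sided.\<close>
  define R where "R = mat_of_cols n (map f [0..<n])"
  have R: "R \<in> carrier_mat n n" unfolding R_def using mat_of_cols_carrier(1)[of n "map f [0..<n]"] by simp
  have QR: "Q * R = 1\<^sub>m n"
  proof (rule mat_col_eqI)
    fix i assume "i < dim_col (1\<^sub>m n :: 'a mat)"
    then have i: "i < n" by simp
    have "col (Q * R) i = Q *\<^sub>v col R i" using col_mult2[OF Q R i] .
    also have "col R i = f i" unfolding R_def using i f by (subst col_mat_of_cols) auto
    also have "Q *\<^sub>v f i = unit_vec n i" using f i by simp
    finally show "col (Q * R) i = col (1\<^sub>m n) i" using i by simp
  qed (use Q R in auto)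
  have RQ: "R * Q = 1\<^sub>m n" using mat_mult_left_right_inverse[OF Q R QR] .
  have ws_lt: "i < d \<Longrightarrow> ws ! i \<in> B" for i using bs by (auto simp: ws_def d_def nth_append)
  have ws_ge: "d \<le> i \<Longrightarrow> i < n \<Longrightarrow> ws ! i \<in> C - B" for i
    using cs len nth_mem[of "i - d" cs] by (auto simp: ws_def d_def nth_append)
  have W_eq: "W = {Q *\<^sub>v c | c. c \<in> carrier_vec n \<and> (\<forall>i. d \<le> i \<and> i < n \<longrightarrow> c $ i = 0)}" (is "W = ?W")
  proof
    show "W \<subseteq> ?W"
    proof
      fix w assume "w \<in> W"
      then obtain a where a: "lincomb a B = w" using finite_in_span[OF Bfin] Bc span_B by auto
      define b where "b = (\<lambda>v. if v \<in> B then a v else 0)"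
      have "lincomb b C = lincomb b (B \<union> (C - B))" using BC by (simp add: Un_absorb1)
      also have "\<dots> = lincomb b B"
        using Bc Cc Bfin Cfin by (intro lincomb_clean) (auto simp: b_def)
      also have "\<dots> = w" unfolding a[symmetric] using Bc by (intro lincomb_cong) (auto simp: b_def)
      finally have "w = Q *\<^sub>v vec n (\<lambda>i. b (ws ! i))" using comb by simp
      then show "w \<in> ?W" using ws_ge by (auto simp: b_def intro!: exI[of _ "vec n (\<lambda>i. b (ws ! i))"])
    qed
    show "?W \<subseteq> W"
    proof
      fix w assume "w \<in> ?W"
      then obtain c where c: "w = Q *\<^sub>v c" "c \<in> carrier_vec n" "\<And>i. d \<le> i \<Longrightarrow> i < n \<Longrightarrow> c $ i = 0"
        by auto
      \<comment> \<open>Turns coordinates indexed by position into coefficients indexed by basis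
        vector; the position is unique because \<open>ws\<close> is distinct.\<close>
      define a where "a = (\<lambda>v. c $ (THE i. i < n \<and> ws ! i = v))"
      have a: "a (ws ! i) = c $ i" if "i < n" for i
      proof -
        have "(THE j. j < n \<and> ws ! j = ws ! i) = i"
          using that ws(2) len by (intro the_equality) (auto simp: nth_eq_iff_index_eq)
        then show ?thesis by (simp add: a_def)
      qed
      have "vec n (\<lambda>i. a (ws ! i)) = c" using a c by (intro eq_vecI) auto
      then have "w = lincomb a C" using comb c by simp
      also have "\<dots> = lincomb a (B \<union> (C - B))" using BC by (simp add: Un_absorb1)
      also have "\<dots> = lincomb a B"
      proof (rule lincomb_clean)
        have "a v = 0" if v: "v \<in> C - B" for v
        proof -
          obtain i where i: "i < n" "v = ws ! i" using v ws len by (metis DiffD1 in_set_conv_nth)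
          then have "d \<le> i" using ws_lt v by (meson DiffD2 linorder_not_less)
          then show ?thesis using a i c by simp
        qed
        then show "a \<in> C - B \<rightarrow> {0}" by auto
      qed (use Bc Cc Bfin Cfin in auto)
      also have "\<dots> \<in> W" using span_B finite_span[OF Bfin] Bc by auto
      finally show "w \<in> W" .
    qed
  qed
  show thesis using that[OF dn Q R QR RQ W_eq] .
qed

text \<open>The matrix of the inverse element is a two-sided inverse of \<open>\<rho> g\<close>, so
  landing in the units follows from these matrix identities. All later work uses this form.\<close>

lemma representation_iff:
  assumes "group G"
  shows "representation G n \<rho> \<longleftrightarrow>
    (\<forall>g \<in> carrier G. \<rho> g \<in> carrier_mat n n) \<and> \<rho> \<one>\<^bsub>G\<^esub> = 1\<^sub>m n \<and>
    (\<forall>g \<in> carrier G. \<forall>h \<in> carrier G. \<rho> (g \<otimes>\<^bsub>G\<^esub> h) = \<rho> g * \<rho> h)" (is "_ \<longleftrightarrow> ?R")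
proof
  interpret G: group G by fact
  let ?M = "ring_mat TYPE(complex) n ()"
  interpret M: ring ?M by (rule ring_mat)
  show ?R if "representation G n \<rho>"
  proof -
    have h: "\<rho> \<in> hom G (units_of ?M)" using that by (simp add: representation_def)
    then have "\<rho> \<one>\<^bsub>G\<^esub> = \<one>\<^bsub>units_of ?M\<^esub>"
      using hom_one[OF h \<open>group G\<close> M.units_group] by simp
    then show ?R using h M.Units_closed
      by (auto simp: hom_def units_of_def ring_mat_simps Pi_def)
  qed
  show "representation G n \<rho>" if R: ?R
  proof -
    have "\<rho> g \<in> Units ?M" if g: "g \<in> carrier G" for g
    proof -
      have "\<rho> g * \<rho> (inv\<^bsub>G\<^esub> g) = 1\<^sub>m n" "\<rho> (inv\<^bsub>G\<^esub> g) * \<rho> g = 1\<^sub>m n"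
        using R g G.inv_closed[OF g] by (metis G.r_inv, metis G.l_inv)
      then show ?thesis using R g unfolding Units_def by (auto simp: ring_mat_simps)
    qed
    then show ?thesis using R by (auto simp: representation_def hom_def units_of_def ring_mat_simps)
  qed
qed

lemma mat_trace_comm:
  assumes "A \<in> carrier_mat n m" "B \<in> carrier_mat m n"
  shows "mat_trace (A * B) = mat_trace (B * (A :: 'a::comm_semiring_0 mat))"
proof -
  have "mat_trace (A * B) = (\<Sum>i<n. \<Sum>j<m. A $$ (i, j) * B $$ (j, i))"
    using assms by (auto simp: mat_trace_def scalar_prod_def atLeast0LessThan)
  also have "\<dots> = (\<Sum>j<m. \<Sum>i<n. B $$ (j, i) * A $$ (i, j))"
    by (subst sum.swap) (simp add: mult.commute)
  also have "\<dots> = mat_trace (B * A)"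
    using assms by (auto simp: mat_trace_def scalar_prod_def atLeast0LessThan)
  finally show ?thesis .
qed

text \<open>Cyclicity of the trace, for rectangular factors. Two sizes \<open>n\<close> and
  \<open>m\<close> are allowed because in Schur's lemma equality of the degrees is not known
  beforehand.\<close>

lemma rep_character_intertwine:
  assumes "\<And>g. g \<in> carrier G \<Longrightarrow> \<rho> g \<in> carrier_mat n n"
    and "\<And>g. g \<in> carrier G \<Longrightarrow> \<psi> g \<in> carrier_mat m m"
    and T: "T \<in> carrier_mat n m" and S: "S \<in> carrier_mat m n"
    and TS: "T * S = 1\<^sub>m n" and ST: "S * T = 1\<^sub>m m"
    and int: "\<And>g. g \<in> carrier G \<Longrightarrow> \<rho> g * T = T * \<psi> g"
  shows "rep_character G \<rho> = rep_character G \<psi>"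
proof -
  have "mat_trace (\<rho> g) = mat_trace (\<psi> g)" if g: "g \<in> carrier G" for g
  proof -
    have \<rho>: "\<rho> g \<in> carrier_mat n n" and \<psi>: "\<psi> g \<in> carrier_mat m m" using assms g by auto
    have "mat_trace (\<rho> g) = mat_trace (\<rho> g * (T * S))" using TS \<rho> by simp
    also have "\<rho> g * (T * S) = (\<rho> g * T) * S" using \<rho> T S by (simp add: assoc_mult_mat)
    also have "\<dots> = T * (\<psi> g * S)" using int[OF g] \<psi> T S by (simp add: assoc_mult_mat)
    also have "mat_trace \<dots> = mat_trace ((\<psi> g * S) * T)"
      using T S \<psi> by (intro mat_trace_comm) auto
    also have "(\<psi> g * S) * T = \<psi> g" using \<psi> S T ST by (simp add: assoc_mult_mat)
    finally show ?thesis .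
  qed
  then show ?thesis by (auto simp: rep_character_def)
qed

text \<open>With a zero lower left block the diagonal blocks multiply independently:
  \<open>\<alpha>\<close> is the action on the invariant subspace, \<open>\<delta>\<close> the
  action on the quotient. The upper right block may be anything, since it does not meet the
  diagonal.\<close>

lemma block_triangular_representation:
  assumes G: "group G" and rep: "representation G n \<rho>" and dn: "d \<le> n"
    and zero: "\<And>g i j. g \<in> carrier G \<Longrightarrow> d \<le> i \<Longrightarrow> i < n \<Longrightarrow> j < d \<Longrightarrow> \<rho> g $$ (i, j) = 0"
  defines "\<alpha> \<equiv> \<lambda>g. mat d d (\<lambda>ij. \<rho> g $$ ij)"
    and "\<delta> \<equiv> \<lambda>g. mat (n - d) (n - d) (\<lambda>(i, j). \<rho> g $$ (i + d, j + d))"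
  shows "representation G d \<alpha>" "representation G (n - d) \<delta>"
    "rep_character G \<rho> = (\<lambda>g. rep_character G \<alpha> g + rep_character G \<delta> g)"
proof -
  interpret G: group G by fact
  have \<rho>: "\<And>g. g \<in> carrier G \<Longrightarrow> \<rho> g \<in> carrier_mat n n" "\<rho> \<one>\<^bsub>G\<^esub> = 1\<^sub>m n"
    and mult: "\<And>g h. g \<in> carrier G \<Longrightarrow> h \<in> carrier G \<Longrightarrow> \<rho> (g \<otimes>\<^bsub>G\<^esub> h) = \<rho> g * \<rho> h"
    using rep unfolding representation_iff[OF G] by auto
  have split: "(\<Sum>k<n. f k) = (\<Sum>k<d. f k) + (\<Sum>k<n - d. f (k + d))" for f :: "nat \<Rightarrow> complex"
    using dn sum.nat_group[of f d] sum.shift_bounds_nat_ivl[of f 0 d "n - d"]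
      sum.atLeastLessThan_concat[of 0 d n f] by (simp add: lessThan_atLeast0)
  \<comment> \<open>The matrix product is split at index \<open>d\<close>. For both indices below
    \<open>d\<close> the second sum vanishes by the zero block of \<open>\<rho> h\<close>; for both
    indices from \<open>d\<close> on the first one vanishes by that of
    \<open>\<rho> g\<close>.\<close>
  have entry: "\<rho> (g \<otimes>\<^bsub>G\<^esub> h) $$ (i, j) =
      (\<Sum>k<d. \<rho> g $$ (i, k) * \<rho> h $$ (k, j)) + (\<Sum>k<n - d. \<rho> g $$ (i, k + d) * \<rho> h $$ (k + d, j))"
    if "g \<in> carrier G" "h \<in> carrier G" "i < n" "j < n" for g h i j
  proof -
    have "\<rho> (g \<otimes>\<^bsub>G\<^esub> h) $$ (i, j) = (\<Sum>k<n. \<rho> g $$ (i, k) * \<rho> h $$ (k, j))"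
      using that \<rho>(1)[of g] \<rho>(1)[of h] by (simp add: mult scalar_prod_def lessThan_atLeast0)
    then show ?thesis by (simp add: split)
  qed
  show "representation G d \<alpha>"
    unfolding representation_iff[OF G] using dn zero
    by (auto simp: \<alpha>_def \<rho>(2) entry scalar_prod_def lessThan_atLeast0 intro!: eq_matI)
  show "representation G (n - d) \<delta>"
    unfolding representation_iff[OF G] using dn zero
    by (auto simp: \<delta>_def \<rho>(2) entry scalar_prod_def lessThan_atLeast0 intro!: eq_matI)
  show "rep_character G \<rho> = (\<lambda>g. rep_character G \<alpha> g + rep_character G \<delta> g)"
    using carrier_matD(1)[OF \<rho>(1)]
    by (auto simp: rep_character_def mat_trace_def \<alpha>_def \<delta>_def split fun_eq_iff)
qed

lemma irr_combination_add:
  "irr_combination G (\<lambda>\<chi>. a \<chi> + b \<chi>) = (\<lambda>g. irr_combination G a g + irr_combination G b g)"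
  by (simp add: irr_combination_def algebra_simps sum.distrib)

lemma irr_combination_zero: "irr_combination G (\<lambda>_. 0) = (\<lambda>_. 0)"
  by (simp add: irr_combination_def)

text \<open>The induction step for decomposing characters: a proper nonzero invariant subspace makes
  both diagonal blocks strictly smaller than \<open>n\<close>.\<close>

lemma rep_character_reducible:
  assumes G: "group G" and rep: "representation G n \<rho>" and n: "n > 0"
    and red: "\<not> irreducible_representation G n \<rho>"
  obtains d \<alpha> \<delta> where "d < n" "representation G d \<alpha>" "n - d < n" "representation G (n - d) \<delta>"
    "rep_character G \<rho> = (\<lambda>g. rep_character G \<alpha> g + rep_character G \<delta> g)"
proof -
  interpret vec_space "TYPE(complex)" n .
  interpret G: group G by fact
  have \<rho>: "\<And>g. g \<in> carrier G \<Longrightarrow> \<rho> g \<in> carrier_mat n n" "\<rho> \<one>\<^bsub>G\<^esub> = 1\<^sub>m n"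
    and mult: "\<And>g h. g \<in> carrier G \<Longrightarrow> h \<in> carrier G \<Longrightarrow> \<rho> (g \<otimes>\<^bsub>G\<^esub> h) = \<rho> g * \<rho> h"
    using rep unfolding representation_iff[OF G] by auto
  obtain W where W: "VectorSpace.subspace class_ring W V" "W \<noteq> {0\<^sub>v n}" "W \<noteq> carrier_vec n"
    and inv: "\<And>g w. g \<in> carrier G \<Longrightarrow> w \<in> W \<Longrightarrow> \<rho> g *\<^sub>v w \<in> W"
    using rep red n unfolding irreducible_representation_def by blast
  obtain d Q R where dn: "d \<le> n" and Q: "Q \<in> carrier_mat n n" and R: "R \<in> carrier_mat n n"
    and QR: "Q * R = 1\<^sub>m n" and RQ: "R * Q = 1\<^sub>m n"
    and W_eq: "W = {Q *\<^sub>v c | c. c \<in> carrier_vec n \<and> (\<forall>i. d \<le> i \<and> i < n \<longrightarrow> c $ i = 0)}"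
    using adapted_basis[OF W(1)] by blast
  have RQv: "R *\<^sub>v (Q *\<^sub>v c) = c" and QRv: "Q *\<^sub>v (R *\<^sub>v c) = c" if "c \<in> carrier_vec n" for c
    using assoc_mult_mat_vec[OF R Q that] assoc_mult_mat_vec[OF Q R that] RQ QR that by simp_all
  have "d \<noteq> 0"
  proof
    assume "d = 0"
    then have "W = {Q *\<^sub>v 0\<^sub>v n}" unfolding W_eq by (auto intro!: exI[of _ "0\<^sub>v n"] arg_cong[of _ _ "(*\<^sub>v) Q"] eq_vecI)
    also have "Q *\<^sub>v 0\<^sub>v n = 0\<^sub>v n" using Q by (intro eq_vecI) auto
    finally show False using W(2) by simp
  qed
  moreover have "d \<noteq> n"
  proof
    assume "d = n"
    then have "W = {Q *\<^sub>v c | c. c \<in> carrier_vec n}" unfolding W_eq by auto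
    also have "\<dots> = carrier_vec n" proof (intro equalityI subsetI)
      fix v :: "complex vec" assume v: "v \<in> carrier_vec n"
      then have "v = Q *\<^sub>v (R *\<^sub>v v)" "R *\<^sub>v v \<in> carrier_vec n" using QRv R by auto
      then show "v \<in> {Q *\<^sub>v c |c. c \<in> carrier_vec n}" by blast
    qed (use Q in auto)
    finally show False using W(3) by simp
  qed
  ultimately have d: "d < n" "n - d < n" using dn n by auto
  \<comment> \<open>The same representation in the adapted basis, as \<open>R\<close> is the inverse
    of \<open>Q\<close>.\<close>
  define \<tau> where "\<tau> = (\<lambda>g. R * (\<rho> g * Q))"
  have \<tau>c: "\<tau> g \<in> carrier_mat n n" if "g \<in> carrier G" for g
    using \<rho>(1)[OF that] Q R by (simp add: \<tau>_def)
  have Q\<tau>: "Q * \<tau> g = \<rho> g * Q" if "g \<in> carrier G" for g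
  proof -
    have "Q * \<tau> g = (Q * R) * (\<rho> g * Q)"
      unfolding \<tau>_def using \<rho>(1)[OF that] Q R by (intro assoc_mult_mat[symmetric]) auto
    then show ?thesis using QR \<rho>(1)[OF that] Q by simp
  qed
  have \<tau>rep: "representation G n \<tau>"
    unfolding representation_iff[OF G]
  proof (intro conjI ballI)
    show "\<tau> \<one>\<^bsub>G\<^esub> = 1\<^sub>m n" using \<rho>(2) Q RQ by (simp add: \<tau>_def)
    fix g h assume g: "g \<in> carrier G" and h: "h \<in> carrier G"
    note c = \<rho>(1)[OF g] \<rho>(1)[OF h] \<tau>c[OF g] \<tau>c[OF h] Q R
    have "\<tau> (g \<otimes>\<^bsub>G\<^esub> h) = R * (\<rho> g * (\<rho> h * Q))"
      using c by (simp add: \<tau>_def mult[OF g h] assoc_mult_mat[of _ n n _ n _ n])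
    also have "\<rho> h * Q = Q * \<tau> h" using Q\<tau>[OF h] by simp
    also have "R * (\<rho> g * (Q * \<tau> h)) = \<tau> g * \<tau> h"
      using c by (simp add: \<tau>_def assoc_mult_mat[of _ n n _ n _ n])
    finally show "\<tau> (g \<otimes>\<^bsub>G\<^esub> h) = \<tau> g * \<tau> h" .
  qed (use \<tau>c in auto)
  have char: "rep_character G \<rho> = rep_character G \<tau>"
    using rep_character_intertwine[of G \<rho> n \<tau> n Q R] \<rho>(1) \<tau>c Q R QR RQ Q\<tau> by simp
  have zero: "\<tau> g $$ (i, j) = 0" if g: "g \<in> carrier G" and i: "d \<le> i" "i < n" and j: "j < d" for g i j
  proof -
    have jn: "j < n" using j dn by simp
    \<comment> \<open>Column \<open>j\<close> of \<open>Q\<close> lies in \<open>W\<close> because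
      \<open>j < d\<close>. Invariance keeps its image in \<open>W\<close>, and applying
      \<open>R\<close> returns coordinates that vanish from \<open>d\<close> on; these form column
      \<open>j\<close> of \<open>\<tau> g\<close>.\<close>
    have "Q *\<^sub>v unit_vec n j \<in> W" unfolding W_eq using j by (auto intro!: exI[of _ "unit_vec n j"])
    then have "\<rho> g *\<^sub>v (Q *\<^sub>v unit_vec n j) \<in> W" using inv g by blast
    then obtain c where c: "\<rho> g *\<^sub>v (Q *\<^sub>v unit_vec n j) = Q *\<^sub>v c" "c \<in> carrier_vec n" "c $ i = 0"
      unfolding W_eq using i by blast
    have "\<tau> g *\<^sub>v unit_vec n j = R *\<^sub>v (\<rho> g *\<^sub>v (Q *\<^sub>v unit_vec n j))"
      unfolding \<tau>_def using \<rho>(1)[OF g] Q R by (simp add: assoc_mult_mat_vec[of _ n n _ n])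
    also have "\<dots> = c" using c RQv by simp
    finally have "(\<tau> g *\<^sub>v unit_vec n j) $ i = 0" using c by simp
    then show ?thesis using \<tau>c[OF g] i jn by (simp add: scalar_prod_right_unit)
  qed
  note block = block_triangular_representation[OF G \<tau>rep dn zero]
  show thesis
    by (rule that[OF d(1) block(1) d(2) block(2)]) (simp_all only: char block(3))
qed

text \<open>Strong induction on the degree. Degree 0 is a separate case because irreducibility
  demands \<open>n > 0\<close>; its trace is an empty sum, matched by zero coefficients.\<close>

lemma rep_character_irr_combination:
  assumes G: "group G" and fin: "finite (Irr G)"
  shows "representation G n \<rho> \<Longrightarrow> \<exists>a. rep_character G \<rho> = irr_combination G a"
proof (induction n arbitrary: \<rho> rule: less_induct)
  case (less n)
  interpret G: group G by fact
  consider "n = 0" | "irreducible_representation G n \<rho>"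
    | "n > 0" "\<not> irreducible_representation G n \<rho>" by blast
  then show ?case
  proof cases
    case 1
    then have "rep_character G \<rho> = irr_combination G (\<lambda>_. 0)"
      using less.prems unfolding representation_iff[OF G]
      by (auto simp: rep_character_def irr_combination_def mat_trace_def fun_eq_iff)
    then show ?thesis by blast
  next
    case 2
    then have "rep_character G \<rho> \<in> Irr G" by (auto simp: Irr_def)
    then have "rep_character G \<rho> = irr_combination G (\<lambda>\<chi>. of_bool (\<chi> = rep_character G \<rho>))"
      using fin by (simp add: irr_combination_def sum.If_cases of_bool_def if_distrib[of of_nat]
        if_distrib[of "\<lambda>x. x * _"] Int_def cong: if_cong conj_cong)
    then show ?thesis by blast
  next
    case 3
    obtain d \<alpha> \<delta> where *: "d < n" "representation G d \<alpha>" "n - d < n" "representation G (n - d) \<delta>"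
      "rep_character G \<rho> = (\<lambda>g. rep_character G \<alpha> g + rep_character G \<delta> g)"
      using rep_character_reducible[OF G less.prems 3] by blast
    obtain a where a: "rep_character G \<alpha> = irr_combination G a" using less.IH[OF *(1,2)] by blast
    obtain b where b: "rep_character G \<delta> = irr_combination G b" using less.IH[OF *(3,4)] by blast
    have "rep_character G \<rho> = irr_combination G (\<lambda>\<chi>. a \<chi> + b \<chi>)"
      by (simp add: irr_combination_add *(5) a b)
    then show ?thesis by blast
  qed
qed

section \<open>Induced characters\<close>

text \<open>Cosets are numbered so that they can serve as matrix indices. The membership
  \<open>x \<otimes> inv (t j) \<in> H\<close> says that \<open>x\<close> lies in the coset
  \<open>H #> t j\<close>, in the shape in which it occurs in the entries of the induced
  representation.\<close>

lemma (in group) right_transversal: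
  assumes H: "subgroup H G" and fin: "finite (carrier G)"
  shows "\<exists>m t. (\<forall>j<m::nat. t j \<in> carrier G) \<and> (\<forall>x\<in>carrier G. \<exists>!j. j < m \<and> x \<otimes> inv (t j) \<in> H)"
proof -
  have "finite (rcosets H)" using fin by (simp add: RCOSETS_def)
  then obtain C where C: "bij_betw C {..<card (rcosets H)} (rcosets H)"
    using ex_bij_betw_nat_finite by (metis atLeast0LessThan)
  define t where "t j = (SOME x. x \<in> carrier G \<and> C j = H #> x)" for j
  have t: "t j \<in> carrier G \<and> C j = H #> t j" if "j < card (rcosets H)" for j
  proof -
    have "C j \<in> rcosets H" using bij_betwE[OF C] that by simp
    then have "\<exists>x. x \<in> carrier G \<and> C j = H #> x" by (auto simp: RCOSETS_def)
    then show ?thesis unfolding t_def by (rule someI_ex)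
  qed
  have mem: "x \<otimes> inv (t j) \<in> H \<longleftrightarrow> C j = H #> x"
    if x: "x \<in> carrier G" and j: "j < card (rcosets H)" for x j
  proof -
    have tj: "t j \<in> carrier G" "C j = H #> t j" using t[OF j] by auto
    have "x \<otimes> inv (t j) \<in> H \<longleftrightarrow> x \<in> H #> t j"
      using subgroup.rcos_module[OF H is_group tj(1) x] by simp
    also have "\<dots> \<longleftrightarrow> H #> t j = H #> x"
      using repr_independence[OF _ tj(1) H] rcos_self[OF x H] by auto
    finally show ?thesis using tj by simp
  qed
  have "\<exists>!j. j < card (rcosets H) \<and> x \<otimes> inv (t j) \<in> H" if x: "x \<in> carrier G" for x
  proof -
    have "H #> x \<in> rcosets H" using x by (auto simp: RCOSETS_def)
    then obtain j where j: "j < card (rcosets H)" "C j = H #> x"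
      using bij_betw_imp_surj_on[OF C] by (metis imageE lessThan_iff)
    show ?thesis
    proof (rule ex1I[of _ j])
      show "j < card (rcosets H) \<and> x \<otimes> inv (t j) \<in> H" using mem[OF x] j by simp
      fix i assume "i < card (rcosets H) \<and> x \<otimes> inv (t i) \<in> H"
      then have "i < card (rcosets H)" "C i = C j" using mem[OF x, of i] j by simp_all
      then show "i = j" using bij_betw_imp_inj_on[OF C] j(1) by (simp add: inj_on_eq_iff)
    qed
  qed
  then show ?thesis using t by (intro exI[of _ "card (rcosets H)"] exI[of _ t]) simp
qed

text \<open>Because \<open>\<mu>\<close> is extended by zero, multiplicativity survives when only
  the left factor lies in \<open>H\<close>: for such \<open>x\<close>, the product with
  \<open>y\<close> is in \<open>H\<close> exactly when \<open>y\<close> is. This asymmetric form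
  spares case distinctions later.\<close>

lemma linear_character_props:
  assumes G: "group G" and H: "subgroup H G" and \<mu>: "\<mu> \<in> linear_characters (G\<lparr>carrier := H\<rparr>)"
  shows "\<mu> \<one>\<^bsub>G\<^esub> = 1" "\<And>x. x \<notin> H \<Longrightarrow> \<mu> x = 0"
    "\<And>x y. x \<in> H \<Longrightarrow> y \<in> carrier G \<Longrightarrow> \<mu> (x \<otimes>\<^bsub>G\<^esub> y) = \<mu> x * \<mu> y"
proof -
  interpret G: group G by fact
  interpret H: subgroup H G by fact
  have K: "group (G\<lparr>carrier := H\<rparr>)" using H.subgroup_is_group[OF G] .
  obtain \<rho> where \<rho>: "representation (G\<lparr>carrier := H\<rparr>) 1 \<rho>" "\<mu> = rep_character (G\<lparr>carrier := H\<rparr>) \<rho>"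
    using \<mu> by (auto simp: linear_characters_def)
  have c: "\<And>h. h \<in> H \<Longrightarrow> \<rho> h \<in> carrier_mat 1 1" and one: "\<rho> \<one>\<^bsub>G\<^esub> = 1\<^sub>m 1"
    and mult: "\<And>g h. g \<in> H \<Longrightarrow> h \<in> H \<Longrightarrow> \<rho> (g \<otimes>\<^bsub>G\<^esub> h) = \<rho> g * \<rho> h"
    using \<rho>(1) unfolding representation_iff[OF K] by auto
  have \<mu>_in: "\<mu> h = \<rho> h $$ (0, 0)" if "h \<in> H" for h
    using c[OF that] that by (simp add: \<rho>(2) rep_character_def mat_trace_def)
  show out: "\<mu> x = 0" if "x \<notin> H" for x using that by (simp add: \<rho>(2) rep_character_def)
  show "\<mu> \<one>\<^bsub>G\<^esub> = 1" using one by (simp add: \<mu>_in)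
  show "\<mu> (x \<otimes>\<^bsub>G\<^esub> y) = \<mu> x * \<mu> y" if x: "x \<in> H" and y: "y \<in> carrier G" for x y
  proof (cases "y \<in> H")
    case True
    have "(\<rho> x * \<rho> y) $$ (0, 0) = \<rho> x $$ (0, 0) * \<rho> y $$ (0, 0)"
      using c[OF x] c[OF True] by (simp add: scalar_prod_def)
    then show ?thesis using True x by (simp add: \<mu>_in mult)
  next
    case False
    have "x \<otimes>\<^bsub>G\<^esub> y \<notin> H"
    proof
      assume "x \<otimes>\<^bsub>G\<^esub> y \<in> H"
      then have "inv\<^bsub>G\<^esub> x \<otimes>\<^bsub>G\<^esub> (x \<otimes>\<^bsub>G\<^esub> y) \<in> H" using x by simp
      then show False using x y False by (simp add: G.m_assoc[symmetric])
    qed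
    then show ?thesis using False out by simp
  qed
qed

text \<open>The induced representation acts on the cosets of \<open>H\<close> by monomial matrices.
  Writing each group element as \<open>h \<otimes> t j\<close>, the terms of the defining sum do not
  depend on \<open>h\<close>, so the sum is \<open>card H\<close> times the trace and the division
  is exact.\<close>

lemma induced_character_is_rep_character:
  assumes G: "group G" and fin: "finite (carrier G)" and H: "subgroup H G"
    and \<mu>: "\<mu> \<in> linear_characters (G\<lparr>carrier := H\<rparr>)"
  shows "\<exists>n \<rho>. representation G n \<rho> \<and> induced_character G H \<mu> = rep_character G \<rho>"
proof -
  interpret group G by fact
  interpret H: subgroup H G by fact
  note one = linear_character_props(1)[OF G H \<mu>] and out = linear_character_props(2)[OF G H \<mu>]
    and mult = linear_character_props(3)[OF G H \<mu>]
  have finH: "finite H" using finite_subset[OF H.subset fin] .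
  then have cardH: "card H > 0" using H.one_closed card_gt_0_iff by blast
  obtain m and t :: "nat \<Rightarrow> _" where mt: "\<forall>j<m. t j \<in> carrier G"
      "\<forall>x\<in>carrier G. \<exists>!j. j < m \<and> x \<otimes>\<^bsub>G\<^esub> inv\<^bsub>G\<^esub> (t j) \<in> H"
    using right_transversal[OF H fin] by (elim exE conjE)
  note t = mt(1)[rule_format] and ex1 = mt(2)[rule_format]
  \<comment> \<open>At most one entry in each row is nonzero, since \<open>\<mu>\<close> is zero off
    \<open>H\<close> and \<open>t i \<otimes> g\<close> lies in a single coset.\<close>
  define \<rho> where "\<rho> g = mat m m (\<lambda>(i, j). \<mu> (t i \<otimes>\<^bsub>G\<^esub> g \<otimes>\<^bsub>G\<^esub> inv\<^bsub>G\<^esub> (t j)))" for g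
  have "representation G m \<rho>"
    unfolding representation_iff[OF G]
  proof (intro conjI ballI)
    show "\<rho> \<one>\<^bsub>G\<^esub> = 1\<^sub>m m"
    proof (rule eq_matI)
      fix i j assume "i < dim_row (1\<^sub>m m :: complex mat)" "j < dim_col (1\<^sub>m m :: complex mat)"
      then have i: "i < m" and j: "j < m" by auto
      have "t i \<otimes>\<^bsub>G\<^esub> inv\<^bsub>G\<^esub> (t j) \<in> H \<longleftrightarrow> i = j"
      proof -
        have "t i \<otimes>\<^bsub>G\<^esub> inv\<^bsub>G\<^esub> (t i) \<in> H" using t[OF i] by simp
        then show ?thesis using ex1[OF t[OF i]] i j by blast
      qed
      then show "\<rho> \<one>\<^bsub>G\<^esub> $$ (i, j) = 1\<^sub>m m $$ (i, j)"
        using i j t one out by (auto simp: \<rho>_def)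
    qed (auto simp: \<rho>_def)
    fix g h assume g: "g \<in> carrier G" and h: "h \<in> carrier G"
    show "\<rho> (g \<otimes>\<^bsub>G\<^esub> h) = \<rho> g * \<rho> h"
    proof (rule eq_matI)
      fix i k assume "i < dim_row (\<rho> g * \<rho> h)" "k < dim_col (\<rho> g * \<rho> h)"
      then have i: "i < m" and k: "k < m" by (auto simp: \<rho>_def)
      let ?x = "t i \<otimes>\<^bsub>G\<^esub> g"
      have x: "?x \<in> carrier G" using t i g by simp
      obtain l where l: "l < m" "?x \<otimes>\<^bsub>G\<^esub> inv\<^bsub>G\<^esub> (t l) \<in> H"
        and uniq: "\<And>j. j < m \<Longrightarrow> j \<noteq> l \<Longrightarrow> ?x \<otimes>\<^bsub>G\<^esub> inv\<^bsub>G\<^esub> (t j) \<notin> H"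
        using ex1[OF x] by blast
      have "(\<rho> g * \<rho> h) $$ (i, k) = (\<Sum>j<m. \<mu> (?x \<otimes>\<^bsub>G\<^esub> inv\<^bsub>G\<^esub> (t j)) * \<mu> (t j \<otimes>\<^bsub>G\<^esub> h \<otimes>\<^bsub>G\<^esub> inv\<^bsub>G\<^esub> (t k)))"
        using i k by (simp add: \<rho>_def scalar_prod_def lessThan_atLeast0)
      also have "\<dots> = (\<Sum>j\<in>{l}. \<mu> (?x \<otimes>\<^bsub>G\<^esub> inv\<^bsub>G\<^esub> (t j)) * \<mu> (t j \<otimes>\<^bsub>G\<^esub> h \<otimes>\<^bsub>G\<^esub> inv\<^bsub>G\<^esub> (t k)))"
        using l uniq out by (intro sum.mono_neutral_right) auto
      \<comment> \<open>The left factor lies in \<open>H\<close> by the choice of \<open>l\<close>,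
        so the one-sided multiplicativity applies whatever the right factor is.\<close>
      also have "\<dots> = \<mu> ((?x \<otimes>\<^bsub>G\<^esub> inv\<^bsub>G\<^esub> (t l)) \<otimes>\<^bsub>G\<^esub> (t l \<otimes>\<^bsub>G\<^esub> h \<otimes>\<^bsub>G\<^esub> inv\<^bsub>G\<^esub> (t k)))"
        using l h t k by (simp add: mult)
      also have "(?x \<otimes>\<^bsub>G\<^esub> inv\<^bsub>G\<^esub> (t l)) \<otimes>\<^bsub>G\<^esub> (t l \<otimes>\<^bsub>G\<^esub> h \<otimes>\<^bsub>G\<^esub> inv\<^bsub>G\<^esub> (t k)) =
          t i \<otimes>\<^bsub>G\<^esub> (g \<otimes>\<^bsub>G\<^esub> h) \<otimes>\<^bsub>G\<^esub> inv\<^bsub>G\<^esub> (t k)"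
      proof -
        let ?y = "h \<otimes>\<^bsub>G\<^esub> inv\<^bsub>G\<^esub> (t k)"
        have "inv\<^bsub>G\<^esub> (t l) \<otimes>\<^bsub>G\<^esub> (t l \<otimes>\<^bsub>G\<^esub> ?y) = ?y"
          using t[OF l(1)] h t[OF k] by (simp add: m_assoc[symmetric])
        then show ?thesis using t[OF l(1)] g h t[OF i] t[OF k] by (simp add: m_assoc)
      qed
      finally show "\<rho> (g \<otimes>\<^bsub>G\<^esub> h) $$ (i, k) = (\<rho> g * \<rho> h) $$ (i, k)"
        using i k by (simp add: \<rho>_def)
    qed (auto simp: \<rho>_def)
  qed (simp add: \<rho>_def)
  moreover have "induced_character G H \<mu> g = rep_character G \<rho> g" for g
  proof (cases "g \<in> carrier G")
    case g: True
    have uniq: "i = j" if "x \<in> carrier G" "i < m" "j < m"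
      "x \<otimes>\<^bsub>G\<^esub> inv\<^bsub>G\<^esub> (t i) \<in> H" "x \<otimes>\<^bsub>G\<^esub> inv\<^bsub>G\<^esub> (t j) \<in> H" for x i j
      using ex1[OF that(1)] that(2-) by blast
    \<comment> \<open>Unique factorisation of a group element into an element of \<open>H\<close>
      and a coset representative.\<close>
    have bij: "bij_betw (\<lambda>(j, h). h \<otimes>\<^bsub>G\<^esub> t j) ({..<m} \<times> H) (carrier G)"
    proof (rule bij_betwI')
      fix p q assume "p \<in> {..<m} \<times> H" "q \<in> {..<m} \<times> H"
      then obtain i h j k where pq: "p = (i, h)" "q = (j, k)" "i < m" "j < m" "h \<in> H" "k \<in> H" by auto
      have "p = q" if eq: "h \<otimes>\<^bsub>G\<^esub> t i = k \<otimes>\<^bsub>G\<^esub> t j"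
      proof -
        have 1: "(h \<otimes>\<^bsub>G\<^esub> t i) \<otimes>\<^bsub>G\<^esub> inv\<^bsub>G\<^esub> (t i) = h" "(k \<otimes>\<^bsub>G\<^esub> t j) \<otimes>\<^bsub>G\<^esub> inv\<^bsub>G\<^esub> (t j) = k"
          using pq(5,6) t[OF pq(3)] t[OF pq(4)] by (simp_all add: m_assoc)
        then have "(h \<otimes>\<^bsub>G\<^esub> t i) \<otimes>\<^bsub>G\<^esub> inv\<^bsub>G\<^esub> (t i) \<in> H" "(h \<otimes>\<^bsub>G\<^esub> t i) \<otimes>\<^bsub>G\<^esub> inv\<^bsub>G\<^esub> (t j) \<in> H"
          using pq(5,6) by (simp, simp add: eq)
        moreover have "h \<otimes>\<^bsub>G\<^esub> t i \<in> carrier G" using pq(5) t[OF pq(3)] by simp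
        ultimately have ij: "i = j" using uniq[OF _ pq(3,4)] by blast
        have "k = h" using 1(1) unfolding eq unfolding ij 1(2) .
        then show ?thesis using ij pq(1,2) by simp
      qed
      then show "((case p of (j, h) \<Rightarrow> h \<otimes>\<^bsub>G\<^esub> t j) = (case q of (j, h) \<Rightarrow> h \<otimes>\<^bsub>G\<^esub> t j)) = (p = q)"
        using pq by auto
    next
      fix p assume "p \<in> {..<m} \<times> H"
      then show "(case p of (j, h) \<Rightarrow> h \<otimes>\<^bsub>G\<^esub> t j) \<in> carrier G" using t by auto
    next
      fix x assume x: "x \<in> carrier G"
      then obtain j where j: "j < m" "x \<otimes>\<^bsub>G\<^esub> inv\<^bsub>G\<^esub> (t j) \<in> H" using ex1 by blast
      have "x = (x \<otimes>\<^bsub>G\<^esub> inv\<^bsub>G\<^esub> (t j)) \<otimes>\<^bsub>G\<^esub> t j" using x t j by (simp add: m_assoc)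
      then show "\<exists>p\<in>{..<m} \<times> H. x = (case p of (j, h) \<Rightarrow> h \<otimes>\<^bsub>G\<^esub> t j)"
        using j by (intro bexI[of _ "(j, x \<otimes>\<^bsub>G\<^esub> inv\<^bsub>G\<^esub> (t j))"]) auto
    qed
    \<comment> \<open>The extension of \<open>\<mu>\<close> by zero is invariant under conjugation
      by \<open>H\<close>: inside \<open>H\<close> the values at \<open>h\<close> and its inverse
      cancel, outside \<open>H\<close> both sides are zero.\<close>
    have conj: "\<mu> (h \<otimes>\<^bsub>G\<^esub> t j \<otimes>\<^bsub>G\<^esub> g \<otimes>\<^bsub>G\<^esub> inv\<^bsub>G\<^esub> (h \<otimes>\<^bsub>G\<^esub> t j)) = \<mu> (t j \<otimes>\<^bsub>G\<^esub> g \<otimes>\<^bsub>G\<^esub> inv\<^bsub>G\<^esub> (t j))"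
      if h: "h \<in> H" and j: "j < m" for h j
    proof -
      let ?y = "t j \<otimes>\<^bsub>G\<^esub> g \<otimes>\<^bsub>G\<^esub> inv\<^bsub>G\<^esub> (t j)"
      have y: "?y \<in> carrier G" using t j g by simp
      have "h \<otimes>\<^bsub>G\<^esub> t j \<otimes>\<^bsub>G\<^esub> g \<otimes>\<^bsub>G\<^esub> inv\<^bsub>G\<^esub> (h \<otimes>\<^bsub>G\<^esub> t j) = h \<otimes>\<^bsub>G\<^esub> (?y \<otimes>\<^bsub>G\<^esub> inv\<^bsub>G\<^esub> h)"
        using h j g t by (simp add: m_assoc inv_mult_group)
      then have eq: "\<mu> (h \<otimes>\<^bsub>G\<^esub> t j \<otimes>\<^bsub>G\<^esub> g \<otimes>\<^bsub>G\<^esub> inv\<^bsub>G\<^esub> (h \<otimes>\<^bsub>G\<^esub> t j)) = \<mu> h * \<mu> (?y \<otimes>\<^bsub>G\<^esub> inv\<^bsub>G\<^esub> h)"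
        using h y by (simp add: mult)
      show ?thesis
      proof (cases "?y \<in> H")
        case True
        have "\<mu> h * \<mu> (inv\<^bsub>G\<^esub> h) = 1" using mult[OF h, of "inv\<^bsub>G\<^esub> h"] h one by simp
        then show ?thesis using eq mult[OF True, of "inv\<^bsub>G\<^esub> h"] h by simp
      next
        case False
        have "?y \<otimes>\<^bsub>G\<^esub> inv\<^bsub>G\<^esub> h \<notin> H"
        proof
          assume "?y \<otimes>\<^bsub>G\<^esub> inv\<^bsub>G\<^esub> h \<in> H"
          then have "?y \<otimes>\<^bsub>G\<^esub> inv\<^bsub>G\<^esub> h \<otimes>\<^bsub>G\<^esub> h \<in> H" using h by blast
          moreover have "?y \<otimes>\<^bsub>G\<^esub> inv\<^bsub>G\<^esub> h \<otimes>\<^bsub>G\<^esub> h = ?y"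
            using m_assoc[OF y, of "inv\<^bsub>G\<^esub> h" h] y h by simp
          ultimately show False using False by simp
        qed
        then show ?thesis using eq False out by simp
      qed
    qed
    have "(\<Sum>x\<in>carrier G. \<mu> (x \<otimes>\<^bsub>G\<^esub> g \<otimes>\<^bsub>G\<^esub> inv\<^bsub>G\<^esub> x)) =
        (\<Sum>(j, h)\<in>{..<m} \<times> H. \<mu> (h \<otimes>\<^bsub>G\<^esub> t j \<otimes>\<^bsub>G\<^esub> g \<otimes>\<^bsub>G\<^esub> inv\<^bsub>G\<^esub> (h \<otimes>\<^bsub>G\<^esub> t j)))"
      by (subst sum.reindex_bij_betw[OF bij, symmetric]) (simp add: case_prod_beta)
    also have "\<dots> = (\<Sum>j<m. \<Sum>h\<in>H. \<mu> (t j \<otimes>\<^bsub>G\<^esub> g \<otimes>\<^bsub>G\<^esub> inv\<^bsub>G\<^esub> (t j)))"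
      unfolding sum.cartesian_product[symmetric] by (intro sum.cong) (auto simp: conj)
    also have "\<dots> = of_nat (card H) * mat_trace (\<rho> g)"
      by (simp add: mat_trace_def \<rho>_def sum_distrib_left)
    finally have sum: "(\<Sum>x\<in>carrier G. \<mu> (x \<otimes>\<^bsub>G\<^esub> g \<otimes>\<^bsub>G\<^esub> inv\<^bsub>G\<^esub> x)) = of_nat (card H) * mat_trace (\<rho> g)" .
    have "(\<Sum>x\<in>carrier G. if x \<otimes>\<^bsub>G\<^esub> g \<otimes>\<^bsub>G\<^esub> inv\<^bsub>G\<^esub> x \<in> H then \<mu> (x \<otimes>\<^bsub>G\<^esub> g \<otimes>\<^bsub>G\<^esub> inv\<^bsub>G\<^esub> x) else 0) =
        (\<Sum>x\<in>carrier G. \<mu> (x \<otimes>\<^bsub>G\<^esub> g \<otimes>\<^bsub>G\<^esub> inv\<^bsub>G\<^esub> x))"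
      by (intro sum.cong) (auto simp: out)
    then show ?thesis using g cardH by (simp add: induced_character_def rep_character_def sum)
  qed (simp add: induced_character_def rep_character_def)
  ultimately show ?thesis by blast
qed

section \<open>Orthogonality of irreducible characters\<close>

text \<open>The intertwiner obtained by averaging an elementary matrix over the group.\<close>

definition averaged_unit ::
    "('g, 'm) monoid_scheme \<Rightarrow> nat \<Rightarrow> ('g \<Rightarrow> complex mat) \<Rightarrow> nat \<Rightarrow> ('g \<Rightarrow> complex mat) \<Rightarrow> nat \<Rightarrow> nat \<Rightarrow> complex mat"
  where "averaged_unit G n \<rho> m \<psi> i k =
    mat n m (\<lambda>(a, b). \<Sum>g\<in>carrier G. \<rho> g $$ (a, i) * \<psi> (inv\<^bsub>G\<^esub> g) $$ (k, b))"

text \<open>The averaged matrix is the sum of \<open>\<rho> g * E * \<psi> (inv g)\<close> with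
  \<open>E\<close> the elementary matrix at \<open>(i, k)\<close>. Multiplying by
  \<open>\<rho> h\<close> on the left translates the summation variable, and the translation
  reappears as \<open>\<psi> h\<close> on the right.\<close>

lemma averaged_unit_intertwines:
  assumes G: "group G" and rep: "representation G n \<rho>" "representation G m \<psi>"
    and i: "i < n" and k: "k < m" and h: "h \<in> carrier G"
  shows "\<rho> h * averaged_unit G n \<rho> m \<psi> i k = averaged_unit G n \<rho> m \<psi> i k * \<psi> h"
proof (rule eq_matI)
  interpret group G by fact
  have \<rho>: "\<And>g. g \<in> carrier G \<Longrightarrow> \<rho> g \<in> carrier_mat n n"
    "\<And>g h. g \<in> carrier G \<Longrightarrow> h \<in> carrier G \<Longrightarrow> \<rho> (g \<otimes>\<^bsub>G\<^esub> h) = \<rho> g * \<rho> h"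
    using rep(1) unfolding representation_iff[OF G] by auto
  have \<psi>: "\<And>g. g \<in> carrier G \<Longrightarrow> \<psi> g \<in> carrier_mat m m"
    "\<And>g h. g \<in> carrier G \<Longrightarrow> h \<in> carrier G \<Longrightarrow> \<psi> (g \<otimes>\<^bsub>G\<^esub> h) = \<psi> g * \<psi> h"
    using rep(2) unfolding representation_iff[OF G] by auto
  note ch = \<rho>(1)[OF h] \<psi>(1)[OF h]
  fix a b
  assume "a < dim_row (averaged_unit G n \<rho> m \<psi> i k * \<psi> h)" "b < dim_col (averaged_unit G n \<rho> m \<psi> i k * \<psi> h)"
  then have a: "a < n" and b: "b < m" using ch by (auto simp: averaged_unit_def)
  have prod\<rho>: "\<rho> (h \<otimes>\<^bsub>G\<^esub> g) $$ (a, i) = (\<Sum>c<n. \<rho> h $$ (a, c) * \<rho> g $$ (c, i))" if "g \<in> carrier G" for g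
    using \<rho>(1)[OF that] ch a i by (simp add: \<rho>(2)[OF h that] scalar_prod_def lessThan_atLeast0)
  have prod\<psi>: "\<psi> (g \<otimes>\<^bsub>G\<^esub> h) $$ (k, b) = (\<Sum>c<m. \<psi> g $$ (k, c) * \<psi> h $$ (c, b))" if "g \<in> carrier G" for g
    using \<psi>(1)[OF that] ch b k by (simp add: \<psi>(2)[OF that h] scalar_prod_def lessThan_atLeast0)
  have "(\<rho> h * averaged_unit G n \<rho> m \<psi> i k) $$ (a, b) =
      (\<Sum>c<n. \<Sum>g\<in>carrier G. \<rho> h $$ (a, c) * \<rho> g $$ (c, i) * \<psi> (inv\<^bsub>G\<^esub> g) $$ (k, b))"
    using ch a b by (simp add: averaged_unit_def scalar_prod_def lessThan_atLeast0 sum_distrib_left mult.assoc)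
  also have "\<dots> = (\<Sum>g\<in>carrier G. \<rho> (h \<otimes>\<^bsub>G\<^esub> g) $$ (a, i) * \<psi> (inv\<^bsub>G\<^esub> g) $$ (k, b))"
    by (subst sum.swap) (simp add: prod\<rho> sum_distrib_right)
  also have "\<dots> = (\<Sum>g\<in>carrier G. \<rho> g $$ (a, i) * \<psi> (inv\<^bsub>G\<^esub> g \<otimes>\<^bsub>G\<^esub> h) $$ (k, b))"
    by (rule sum.reindex_bij_witness[of _ "\<lambda>g. inv\<^bsub>G\<^esub> h \<otimes>\<^bsub>G\<^esub> g" "\<lambda>g. h \<otimes>\<^bsub>G\<^esub> g"])
      (use h in \<open>auto simp: m_assoc[symmetric] inv_mult_group, simp add: m_assoc\<close>)
  also have "\<dots> = (\<Sum>c<m. \<Sum>g\<in>carrier G. \<rho> g $$ (a, i) * \<psi> (inv\<^bsub>G\<^esub> g) $$ (k, c) * \<psi> h $$ (c, b))"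
    by (subst sum.swap) (simp add: prod\<psi> sum_distrib_left mult.assoc)
  also have "\<dots> = (averaged_unit G n \<rho> m \<psi> i k * \<psi> h) $$ (a, b)"
    using ch a b by (simp add: averaged_unit_def scalar_prod_def lessThan_atLeast0 sum_distrib_right)
  finally show "(\<rho> h * averaged_unit G n \<rho> m \<psi> i k) $$ (a, b) = (averaged_unit G n \<rho> m \<psi> i k * \<psi> h) $$ (a, b)" .
qed (use assms in \<open>auto simp: averaged_unit_def representation_iff\<close>)

section \<open>Schur's lemma and the orthogonality relation it yields\<close>

lemma mult_mat_vec_zero: "A \<in> carrier_mat n m \<Longrightarrow> A *\<^sub>v 0\<^sub>v m = (0\<^sub>v n :: 'a::semiring_0 vec)"
  by (intro eq_vecI) auto

lemma mat_mult_unit_vec: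
  fixes A :: "'a::semiring_1 mat"
  assumes "A \<in> carrier_mat n m" "j < m"
  shows "A *\<^sub>v unit_vec m j = col A j"
  using assms by (intro eq_vecI) auto

text \<open>The kernel is an invariant subspace with a nonzero element, so irreducibility makes it
  everything. Invariance of the kernel is the hypothesis, so that the lemma serves both an
  intertwiner and its shift by an eigenvalue.\<close>

lemma irreducible_kernel:
  assumes irr: "irreducible_representation G m \<psi>"
    and T: "T \<in> carrier_mat n m"
    and inv: "\<And>g v. g \<in> carrier G \<Longrightarrow> v \<in> carrier_vec m \<Longrightarrow> T *\<^sub>v v = 0\<^sub>v n \<Longrightarrow>
      \<psi> g *\<^sub>v v \<in> carrier_vec m \<and> T *\<^sub>v (\<psi> g *\<^sub>v v) = 0\<^sub>v n"
    and nontriv: "v \<in> carrier_vec m" "v \<noteq> 0\<^sub>v m" "T *\<^sub>v v = 0\<^sub>v n"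
  shows "T = 0\<^sub>m n m"
proof -
  let ?W = "{v \<in> carrier_vec m. T *\<^sub>v v = 0\<^sub>v n}"
  have "VectorSpace.subspace class_ring ?W (module_vec TYPE(complex) m)"
    using T by (intro subspace_vecI) (auto simp: mult_add_distrib_mat_vec mult_mat_vec mult_mat_vec_zero)
  moreover have "\<forall>g\<in>carrier G. \<forall>w\<in>?W. \<psi> g *\<^sub>v w \<in> ?W" using inv by blast
  ultimately have "?W = carrier_vec m"
    using irr nontriv unfolding irreducible_representation_def by blast
  then have ker: "T *\<^sub>v v = 0\<^sub>v n" if "v \<in> carrier_vec m" for v using that by blast
  show ?thesis
  proof (rule mat_col_eqI)
    fix j assume "j < dim_col (0\<^sub>m n m :: complex mat)"
    then have j: "j < m" by simp
    have "col T j = T *\<^sub>v unit_vec m j" using mat_mult_unit_vec[OF T j] by simp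
    then show "col T j = col (0\<^sub>m n m) j" using ker j by simp
  qed (use T in auto)
qed

text \<open>A nonzero intertwiner has trivial kernel since \<open>\<psi>\<close> is irreducible and
  full image since \<open>\<rho>\<close> is, so it is invertible and forces equal characters.
  Assuming different characters instead of inequivalent representations matches \<open>Irr\<close>,
  whose elements are functions.\<close>

lemma schur_different:
  assumes G: "group G" and irr: "irreducible_representation G n \<rho>" "irreducible_representation G m \<psi>"
    and neq: "rep_character G \<rho> \<noteq> rep_character G \<psi>"
    and T: "T \<in> carrier_mat n m" and int: "\<And>g. g \<in> carrier G \<Longrightarrow> \<rho> g * T = T * \<psi> g"
  shows "T = 0\<^sub>m n m"
proof (rule ccontr)
  assume T0: "T \<noteq> 0\<^sub>m n m"
  have \<rho>: "\<And>g. g \<in> carrier G \<Longrightarrow> \<rho> g \<in> carrier_mat n n"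
    using irr(1) by (simp add: irreducible_representation_def representation_iff[OF G])
  have \<psi>: "\<And>g. g \<in> carrier G \<Longrightarrow> \<psi> g \<in> carrier_mat m m"
    using irr(2) by (simp add: irreducible_representation_def representation_iff[OF G])
  have intv: "\<rho> g *\<^sub>v (T *\<^sub>v v) = T *\<^sub>v (\<psi> g *\<^sub>v v)" if "g \<in> carrier G" "v \<in> carrier_vec m" for g v
    using assoc_mult_mat_vec[OF \<rho>[OF that(1)] T that(2)] assoc_mult_mat_vec[OF T \<psi>[OF that(1)] that(2)]
      int[OF that(1)] by simp
  have inj: "v = 0\<^sub>v m" if v: "v \<in> carrier_vec m" "T *\<^sub>v v = 0\<^sub>v n" for v
  proof (rule ccontr)
    assume "v \<noteq> 0\<^sub>v m"
    moreover have "\<psi> g *\<^sub>v w \<in> carrier_vec m \<and> T *\<^sub>v (\<psi> g *\<^sub>v w) = 0\<^sub>v n"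
      if "g \<in> carrier G" "w \<in> carrier_vec m" "T *\<^sub>v w = 0\<^sub>v n" for g w
      using intv[OF that(1,2)] that \<psi>[OF that(1)] \<rho>[OF that(1)] by (simp add: mult_mat_vec_zero)
    ultimately show False using irreducible_kernel[OF irr(2) T _ v(1) _ v(2)] T0 by blast
  qed
  let ?W = "{T *\<^sub>v v | v. v \<in> carrier_vec m}"
  have sub: "VectorSpace.subspace class_ring ?W (module_vec TYPE(complex) n)"
  proof (rule subspace_vecI)
    show "?W \<subseteq> carrier_vec n" using T by auto
    show "0\<^sub>v n \<in> ?W" using mult_mat_vec_zero[OF T] by (auto intro!: exI[of _ "0\<^sub>v m"])
    show "v + w \<in> ?W" if "v \<in> ?W" "w \<in> ?W" for v w
      using that by (auto simp: mult_add_distrib_mat_vec[OF T, symmetric])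
    show "c \<cdot>\<^sub>v v \<in> ?W" if "v \<in> ?W" for v c
      using that by (auto simp: mult_mat_vec[OF T, symmetric])
  qed
  have "?W \<noteq> {0\<^sub>v n}"
  proof
    assume W: "?W = {0\<^sub>v n}"
    have m: "m > 0" using irr(2) by (simp add: irreducible_representation_def)
    have "T *\<^sub>v unit_vec m 0 \<in> ?W" by (auto intro!: exI[of _ "unit_vec m 0"])
    then have "T *\<^sub>v unit_vec m 0 = 0\<^sub>v n" unfolding W by (rule singletonD)
    then have "unit_vec m 0 = (0\<^sub>v m :: complex vec)" by (intro inj unit_vec_carrier)
    then show False using m by (metis index_unit_vec(2) index_zero_vec(1) zero_neq_one)
  qed
  moreover have "\<forall>g\<in>carrier G. \<forall>w\<in>?W. \<rho> g *\<^sub>v w \<in> ?W" using intv mult_mat_vec_carrier[OF \<psi>] by fast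
  ultimately have W: "?W = carrier_vec n" using irr(1) sub unfolding irreducible_representation_def by blast
  have "\<exists>v. v \<in> carrier_vec m \<and> T *\<^sub>v v = unit_vec n i" for i
  proof -
    have "unit_vec n i \<in> ?W" using W by simp
    then show ?thesis by auto
  qed
  then obtain f where f: "\<And>i. f i \<in> carrier_vec m" "\<And>i. T *\<^sub>v f i = unit_vec n i" by metis
  define S where "S = mat_of_cols m (map f [0..<n])"
  have S: "S \<in> carrier_mat m n" unfolding S_def using mat_of_cols_carrier(1)[of m "map f [0..<n]"] by simp
  have TS: "T * S = 1\<^sub>m n"
  proof (rule mat_col_eqI)
    fix i assume "i < dim_col (1\<^sub>m n :: complex mat)"
    then have i: "i < n" by simp
    have "col S i = f i" unfolding S_def using i f by (subst col_mat_of_cols) auto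
    then show "col (T * S) i = col (1\<^sub>m n) i" using i col_mult2[OF T S i] f by simp
  qed (use T S in auto)
  have ST: "S * T = 1\<^sub>m m"
  proof (rule mat_col_eqI)
    fix j assume "j < dim_col (1\<^sub>m m :: complex mat)"
    then have j: "j < m" by simp
    let ?e = "unit_vec m j :: complex vec"
    have ST_e: "(S * T) *\<^sub>v ?e \<in> carrier_vec m" using S T by auto
    \<comment> \<open>\<open>T\<close> is not known to be square, so the left inverse property is
      taken from injectivity: \<open>T\<close> sends the difference of
      \<open>(S * T) *\<^sub>v ?e\<close> and \<open>?e\<close> to zero.\<close>
    have "T *\<^sub>v ((S * T) *\<^sub>v ?e) = (T * S) *\<^sub>v (T *\<^sub>v ?e)"
      using T S by (simp add: assoc_mult_mat_vec[of _ m n _ m] assoc_mult_mat_vec[of _ n m _ n])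
    also have "\<dots> = T *\<^sub>v ?e" using TS T by simp
    finally have "T *\<^sub>v ((S * T) *\<^sub>v ?e - ?e) = 0\<^sub>v n"
      using T ST_e by (simp add: mult_minus_distrib_mat_vec[OF T])
    then have 0: "(S * T) *\<^sub>v ?e - ?e = 0\<^sub>v m" using ST_e by (intro inj) auto
    have "(S * T) *\<^sub>v ?e = ?e"
    proof (rule eq_vecI)
      fix a assume "a < dim_vec ?e"
      then show "((S * T) *\<^sub>v ?e) $ a = ?e $ a" using arg_cong[OF 0, of "\<lambda>v. v $ a"] ST_e by auto
    qed (use S T in auto)
    then show "col (S * T) j = col (1\<^sub>m m) j"
      using mat_mult_unit_vec[of "S * T" m m j] S T j by simp
  qed (use T S in auto)
  have "rep_character G \<rho> = rep_character G \<psi>"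
    using \<rho> \<psi> T S TS ST int by (rule rep_character_intertwine)
  then show False using neq by simp
qed

text \<open>Over the complex numbers, and in positive degree, \<open>T\<close> has an eigenvalue
  \<open>c\<close>. The matrix \<open>T - c\<close> still commutes with the representation and kills
  an eigenvector, hence is zero.\<close>

lemma schur_same:
  assumes G: "group G" and irr: "irreducible_representation G n \<rho>"
    and T: "T \<in> carrier_mat n n" and int: "\<And>g. g \<in> carrier G \<Longrightarrow> \<rho> g * T = T * \<rho> g"
  shows "\<exists>c. T = c \<cdot>\<^sub>m 1\<^sub>m n"
proof -
  have \<rho>: "\<And>g. g \<in> carrier G \<Longrightarrow> \<rho> g \<in> carrier_mat n n" and n: "n > 0"
    using irr by (simp_all add: irreducible_representation_def representation_iff[OF G])
  obtain c v where "eigenvector T v c"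
    using spectrum_non_empty[OF T n] by (auto simp: spectrum_def eigenvalue_def)
  then have v: "v \<in> carrier_vec n" "v \<noteq> 0\<^sub>v n" "T *\<^sub>v v = c \<cdot>\<^sub>v v"
    using T by (auto simp: eigenvector_def)
  define S where "S = T - c \<cdot>\<^sub>m 1\<^sub>m n"
  have S: "S \<in> carrier_mat n n" using T by (auto simp: S_def)
  have Sv: "S *\<^sub>v w = T *\<^sub>v w - c \<cdot>\<^sub>v w" if "w \<in> carrier_vec n" for w
    using T that by (intro eq_vecI) (auto simp: S_def minus_mult_distrib_mat_vec[of _ n n])
  have "\<rho> g *\<^sub>v w \<in> carrier_vec n \<and> S *\<^sub>v (\<rho> g *\<^sub>v w) = 0\<^sub>v n"
    if g: "g \<in> carrier G" and w: "w \<in> carrier_vec n" "S *\<^sub>v w = 0\<^sub>v n" for g w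
  proof -
    have "S *\<^sub>v (\<rho> g *\<^sub>v w) = (T * \<rho> g) *\<^sub>v w - c \<cdot>\<^sub>v (\<rho> g *\<^sub>v w)"
      using Sv \<rho>[OF g] w(1) T by simp
    also have "\<dots> = \<rho> g *\<^sub>v (T *\<^sub>v w) - \<rho> g *\<^sub>v (c \<cdot>\<^sub>v w)"
      using int[OF g, symmetric] \<rho>[OF g] w(1) T by (simp add: mult_mat_vec[OF \<rho>[OF g]])
    also have "\<dots> = \<rho> g *\<^sub>v (S *\<^sub>v w)"
      using \<rho>[OF g] w(1) T Sv by (simp add: mult_minus_distrib_mat_vec[of _ n n])
    finally show ?thesis using w \<rho>[OF g] by (simp add: mult_mat_vec_zero)
  qed
  moreover have "S *\<^sub>v v = 0\<^sub>v n" using Sv[OF v(1)] v by simp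
  ultimately have S0: "S = 0\<^sub>m n n" using irreducible_kernel[OF irr S _ v(1,2)] by blast
  have "T = c \<cdot>\<^sub>m 1\<^sub>m n"
  proof (rule eq_matI)
    fix i j assume "i < dim_row (c \<cdot>\<^sub>m 1\<^sub>m n)" "j < dim_col (c \<cdot>\<^sub>m 1\<^sub>m n)"
    then show "T $$ (i, j) = (c \<cdot>\<^sub>m 1\<^sub>m n) $$ (i, j)"
      using arg_cong[OF S0, of "\<lambda>M. M $$ (i, j)"] T by (auto simp: S_def)
  qed (use T in auto)
  then show ?thesis by blast
qed

text \<open>Expanding both traces gives products of diagonal entries \<open>(i, i)\<close> and
  \<open>(k, k)\<close>. Their sum over the group is the \<open>(i, k)\<close> entry of the average
  of the elementary matrix at that same position.\<close>

lemma sum_character_products: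
  assumes G: "group G" and rep: "representation G n \<rho>" "representation G m \<psi>"
  shows "(\<Sum>g\<in>carrier G. rep_character G \<rho> g * rep_character G \<psi> (inv\<^bsub>G\<^esub> g)) =
    (\<Sum>i<n. \<Sum>k<m. averaged_unit G n \<rho> m \<psi> i k $$ (i, k))"
proof -
  interpret group G by fact
  have "(\<Sum>g\<in>carrier G. rep_character G \<rho> g * rep_character G \<psi> (inv\<^bsub>G\<^esub> g)) =
      (\<Sum>g\<in>carrier G. \<Sum>i<n. \<Sum>k<m. \<rho> g $$ (i, i) * \<psi> (inv\<^bsub>G\<^esub> g) $$ (k, k))"
  proof (rule sum.cong[OF refl])
    fix g assume g: "g \<in> carrier G"
    have "\<rho> g \<in> carrier_mat n n" "\<psi> (inv\<^bsub>G\<^esub> g) \<in> carrier_mat m m"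
      using rep g unfolding representation_iff[OF G] by auto
    then show "rep_character G \<rho> g * rep_character G \<psi> (inv\<^bsub>G\<^esub> g) =
        (\<Sum>i<n. \<Sum>k<m. \<rho> g $$ (i, i) * \<psi> (inv\<^bsub>G\<^esub> g) $$ (k, k))"
      using g by (simp add: rep_character_def mat_trace_def sum_product)
  qed
  also have "\<dots> = (\<Sum>i<n. \<Sum>k<m. \<Sum>g\<in>carrier G. \<rho> g $$ (i, i) * \<psi> (inv\<^bsub>G\<^esub> g) $$ (k, k))"
    by (subst sum.swap, rule sum.cong[OF refl], rule sum.swap)
  finally show ?thesis by (simp add: averaged_unit_def)
qed

lemma character_orthogonality:
  assumes G: "group G" and Irr: "\<phi> \<in> Irr G" "\<psi> \<in> Irr G"
  shows "(\<Sum>g\<in>carrier G. \<phi> g * \<psi> (inv\<^bsub>G\<^esub> g)) = (if \<phi> = \<psi> then of_nat (card (carrier G)) else 0)"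
proof -
  interpret group G by fact
  obtain n \<rho> where \<rho>: "irreducible_representation G n \<rho>" "\<phi> = rep_character G \<rho>"
    using Irr by (auto simp: Irr_def)
  then have rep\<rho>: "representation G n \<rho>" by (simp add: irreducible_representation_def)
  show ?thesis
  proof (cases "\<phi> = \<psi>")
    case False
    obtain m \<tau> where \<tau>: "irreducible_representation G m \<tau>" "\<psi> = rep_character G \<tau>"
      using Irr by (auto simp: Irr_def)
    then have rep\<tau>: "representation G m \<tau>" by (simp add: irreducible_representation_def)
    have "averaged_unit G n \<rho> m \<tau> i k = 0\<^sub>m n m" if "i < n" "k < m" for i k
      using False \<rho> \<tau> averaged_unit_intertwines[OF G rep\<rho> rep\<tau> that]
      by (intro schur_different[OF G \<rho>(1) \<tau>(1)]) (simp_all, simp add: averaged_unit_def)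
    then show ?thesis using sum_character_products[OF G rep\<rho> rep\<tau>] False \<rho> \<tau> by simp
  next
    \<comment> \<open>Both factors are realised by the same \<open>\<rho>\<close>, so each averaged
      matrix is scalar.\<close>
    case True
    have n: "n > 0" using \<rho> by (simp add: irreducible_representation_def)
    have entry: "averaged_unit G n \<rho> n \<rho> i k $$ (i, k) = (if i = k then of_nat (card (carrier G)) / of_nat n else 0)"
      if i: "i < n" and k: "k < n" for i k
    proof -
      let ?T = "averaged_unit G n \<rho> n \<rho> i k"
      have "?T \<in> carrier_mat n n" by (simp add: averaged_unit_def)
      then obtain c where c: "?T = c \<cdot>\<^sub>m 1\<^sub>m n"
        using schur_same[OF G \<rho>(1)] averaged_unit_intertwines[OF G rep\<rho> rep\<rho> i k] by blast
      \<comment> \<open>The scalar \<open>c\<close> is determined by the trace. Each group element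
        contributes the \<open>(k, i)\<close> entry of \<open>\<rho> (inv g) * \<rho> g\<close>, the
        identity, so \<open>n * c\<close> is the group order if \<open>i = k\<close> and zero
        otherwise.\<close>
      have "(\<Sum>a<n. \<rho> g $$ (a, i) * \<rho> (inv\<^bsub>G\<^esub> g) $$ (k, a)) = (if i = k then 1 else 0)"
        if g: "g \<in> carrier G" for g
      proof -
        have cm: "\<rho> g \<in> carrier_mat n n" "\<rho> (inv\<^bsub>G\<^esub> g) \<in> carrier_mat n n"
          and "\<rho> (inv\<^bsub>G\<^esub> g) * \<rho> g = 1\<^sub>m n"
          using rep\<rho> g unfolding representation_iff[OF G] by (auto, metis l_inv inv_closed)
        then have "(\<rho> (inv\<^bsub>G\<^esub> g) * \<rho> g) $$ (k, i) = (if i = k then 1 else 0)" using i k by simp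
        then show ?thesis using cm i k by (simp add: scalar_prod_def lessThan_atLeast0 mult.commute)
      qed
      then have "(\<Sum>g\<in>carrier G. \<Sum>a<n. \<rho> g $$ (a, i) * \<rho> (inv\<^bsub>G\<^esub> g) $$ (k, a)) =
          (if i = k then of_nat (card (carrier G)) else 0)"
        by simp
      then have "(\<Sum>a<n. ?T $$ (a, a)) = (if i = k then of_nat (card (carrier G)) else 0)"
        using sum.swap[of "\<lambda>a g. \<rho> g $$ (a, i) * \<rho> (inv\<^bsub>G\<^esub> g) $$ (k, a)" "carrier G" "{..<n}"]
        by (simp add: averaged_unit_def)
      moreover have "(\<Sum>a<n. ?T $$ (a, a)) = of_nat n * c" by (simp add: c)
      ultimately have "c = (if i = k then of_nat (card (carrier G)) / of_nat n else 0)"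
        using n by (auto simp: field_simps)
      then show ?thesis using c i k by auto
    qed
    then show ?thesis
      using sum_character_products[OF G rep\<rho> rep\<rho>] True \<rho> n by simp
  qed
qed

section \<open>Coefficients recovered by pairing with irreducible characters\<close>

lemma irr_combination_inner:
  assumes G: "group G" and finI: "finite (Irr G)" and \<psi>: "\<psi> \<in> Irr G"
  shows "(\<Sum>g\<in>carrier G. irr_combination G a g * \<psi> (inv\<^bsub>G\<^esub> g)) = of_nat (a \<psi> * card (carrier G))"
proof -
  have "(\<Sum>g\<in>carrier G. irr_combination G a g * \<psi> (inv\<^bsub>G\<^esub> g)) =
      (\<Sum>\<phi>\<in>Irr G. of_nat (a \<phi>) * (\<Sum>g\<in>carrier G. \<phi> g * \<psi> (inv\<^bsub>G\<^esub> g)))"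
    unfolding irr_combination_def sum_distrib_right sum_distrib_left
    by (subst sum.swap) (simp add: mult.assoc)
  also have "\<dots> = (\<Sum>\<phi>\<in>Irr G. if \<phi> = \<psi> then of_nat (a \<psi> * card (carrier G)) else 0)"
    using character_orthogonality[OF G _ \<psi>] by (intro sum.cong) auto
  finally show ?thesis using finI \<psi> by simp
qed

text \<open>Agreement is claimed only on \<open>Irr G\<close>, because a coefficient function is
  arbitrary elsewhere. The complex identity from the pairing descends to natural numbers, where the
  group order cancels.\<close>

lemma irr_combination_unique:
  assumes G: "group G" and fin: "finite (carrier G)" and finI: "finite (Irr G)" and \<psi>: "\<psi> \<in> Irr G"
    and eq: "irr_combination G a = irr_combination G b"
  shows "a \<psi> = b \<psi>"
proof -
  interpret group G by fact
  have "of_nat (a \<psi> * card (carrier G)) = (of_nat (b \<psi> * card (carrier G)) :: complex)"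
    using irr_combination_inner[OF G finI \<psi>] eq by metis
  then have "a \<psi> * card (carrier G) = b \<psi> * card (carrier G)" by (simp only: of_nat_eq_iff)
  moreover have "card (carrier G) \<noteq> 0" using fin one_closed by auto
  ultimately show ?thesis by simp
qed

lemma irr_coeff_irr_combination:
  assumes "group G" "finite (carrier G)" "finite (Irr G)" "\<psi> \<in> Irr G"
  shows "irr_coeff G (irr_combination G a) \<psi> = a \<psi>"
  unfolding irr_coeff_def
proof (rule the_equality)
  fix m assume "\<exists>b. irr_combination G a = irr_combination G b \<and> b \<psi> = m"
  then obtain b where b: "irr_combination G a = irr_combination G b" "b \<psi> = m" by blast
  show "m = a \<psi>" using irr_combination_unique[OF assms b(1)] b(2) by simp
qed blast

lemma constituent_irr_combination:
  assumes "group G" "finite (carrier G)" "finite (Irr G)" "\<psi> \<in> Irr G"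
  shows "constituent G \<psi> (irr_combination G a) \<longleftrightarrow> a \<psi> > 0"
proof
  assume "constituent G \<psi> (irr_combination G a)"
  then obtain b where b: "irr_combination G a = irr_combination G b" "b \<psi> > 0"
    by (auto simp: constituent_def)
  show "a \<psi> > 0" using irr_combination_unique[OF assms b(1)] b(2) by simp
next
  assume "a \<psi> > 0"
  then show "constituent G \<psi> (irr_combination G a)" using assms(4) unfolding constituent_def by blast
qed

section \<open>Separation of irreducible characters\<close>

lemma separation_generated_submonoid:
  assumes G: "group G" "finite (carrier G)" "finite (Irr G)" and \<phi>: "\<phi> \<in> Irr G" and \<psi>: "\<psi> \<in> Irr G"
    and B: "B \<subseteq> range (irr_combination G)"
  shows "(\<exists>\<theta> \<in> generated_submonoid B. irr_coeff G \<theta> \<phi> > 0 \<and> irr_coeff G \<theta> \<psi> = 0) \<longleftrightarrow>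
    (\<exists>\<theta> \<in> B. irr_coeff G \<theta> \<phi> > 0 \<and> irr_coeff G \<theta> \<psi> = 0)"
proof -
  note coeff = irr_coeff_irr_combination[OF G]
  \<comment> \<open>The induction carries an explicit coefficient function: additivity is evident
    for such functions but not for the definite description \<open>irr_coeff\<close>, which is
    translated only at the end.\<close>
  have *: "\<exists>a. \<theta> = irr_combination G a \<and>
      (a \<phi> > 0 \<and> a \<psi> = 0 \<longrightarrow> (\<exists>\<beta> \<in> B. irr_coeff G \<beta> \<phi> > 0 \<and> irr_coeff G \<beta> \<psi> = 0))"
    if "\<theta> \<in> generated_submonoid B" for \<theta>
    using that
  proof induction
    case zero
    show ?case by (intro exI[of _ "\<lambda>_. 0"]) (simp add: irr_combination_zero)
  next
    case (base \<theta>)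
    then obtain a where a: "\<theta> = irr_combination G a" using B by blast
    then have "irr_coeff G \<theta> \<phi> = a \<phi>" "irr_coeff G \<theta> \<psi> = a \<psi>"
      using coeff[OF \<phi>] coeff[OF \<psi>] by simp_all
    then show ?case using a base by (intro exI[of _ a] conjI impI bexI[of _ \<theta>]) simp_all
  next
    case (add \<theta> \<eta>)
    let ?S = "\<exists>\<beta> \<in> B. irr_coeff G \<beta> \<phi> > 0 \<and> irr_coeff G \<beta> \<psi> = 0"
    obtain a where a: "\<theta> = irr_combination G a" "a \<phi> > 0 \<and> a \<psi> = 0 \<longrightarrow> ?S" using add.IH(1) by blast
    obtain b where b: "\<eta> = irr_combination G b" "b \<phi> > 0 \<and> b \<psi> = 0 \<longrightarrow> ?S" using add.IH(2) by blast
    show ?case using a b by (intro exI[of _ "\<lambda>\<chi>. a \<chi> + b \<chi>"]) (auto simp: irr_combination_add)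
  qed
  have "\<exists>\<beta> \<in> B. irr_coeff G \<beta> \<phi> > 0 \<and> irr_coeff G \<beta> \<psi> = 0"
    if \<theta>: "\<theta> \<in> generated_submonoid B" "irr_coeff G \<theta> \<phi> > 0" "irr_coeff G \<theta> \<psi> = 0" for \<theta>
  proof -
    obtain a where a: "\<theta> = irr_combination G a"
      "a \<phi> > 0 \<and> a \<psi> = 0 \<longrightarrow> (\<exists>\<beta> \<in> B. irr_coeff G \<beta> \<phi> > 0 \<and> irr_coeff G \<beta> \<psi> = 0)"
      using *[OF \<theta>(1)] by blast
    show ?thesis using \<theta>(2,3) a(2) unfolding a(1) coeff[OF \<phi>] coeff[OF \<psi>] by blast
  qed
  then show ?thesis using generated_submonoid.base by blast
qed

lemma monomial_character_irr_combination:
  assumes "group G" "finite (carrier G)" "finite (Irr G)"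
  shows "monomial_characters G \<subseteq> range (irr_combination G)"
proof
  fix \<theta> assume "\<theta> \<in> monomial_characters G"
  then obtain H \<mu> where H: "subgroup H G" "\<mu> \<in> linear_characters (G\<lparr>carrier := H\<rparr>)"
    and \<theta>: "\<theta> = induced_character G H \<mu>"
    unfolding monomial_characters_def by blast
  obtain n \<rho> where "representation G n \<rho>" "\<theta> = rep_character G \<rho>"
    using induced_character_is_rep_character[OF assms(1,2) H] \<theta> by blast
  then show "\<theta> \<in> range (irr_combination G)"
    using rep_character_irr_combination[OF assms(1,3)] by blast
qed

text \<open>\<open>constituent\<close> asks for some expansion with positive coefficient,
  \<open>irr_coeff\<close> describes the coefficient. They agree here because a monomial character
  has an expansion and its coefficients on \<open>Irr G\<close> are unique.\<close>

lemma almost_monomial_iff_irr_coeff: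
  assumes G: "group G" "finite (carrier G)" "finite (Irr G)"
  shows "almost_monomial G \<longleftrightarrow>
    (\<forall>\<phi> \<in> Irr G. \<forall>\<psi> \<in> Irr G. \<phi> \<noteq> \<psi> \<longrightarrow>
      (\<exists>\<theta> \<in> monomial_characters G. irr_coeff G \<theta> \<phi> > 0 \<and> irr_coeff G \<theta> \<psi> = 0))"
proof -
  have const: "constituent G \<phi> \<theta> \<longleftrightarrow> irr_coeff G \<theta> \<phi> > 0"
    if \<theta>: "\<theta> \<in> monomial_characters G" and \<phi>: "\<phi> \<in> Irr G" for \<theta> \<phi>
  proof -
    obtain a where a: "\<theta> = irr_combination G a" using monomial_character_irr_combination[OF G] \<theta> by blast
    show ?thesis
      unfolding a constituent_irr_combination[OF G \<phi>] irr_coeff_irr_combination[OF G \<phi>] ..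
  qed
  have "almost_monomial G \<longleftrightarrow>
    (\<forall>\<phi> \<in> Irr G. \<forall>\<psi> \<in> Irr G. \<phi> \<noteq> \<psi> \<longrightarrow>
      (\<exists>\<theta> \<in> monomial_characters G. constituent G \<phi> \<theta> \<and> \<not> constituent G \<psi> \<theta>))"
    unfolding almost_monomial_def monomial_characters_def by blast
  also have "\<dots> \<longleftrightarrow> (\<forall>\<phi> \<in> Irr G. \<forall>\<psi> \<in> Irr G. \<phi> \<noteq> \<psi> \<longrightarrow>
      (\<exists>\<theta> \<in> monomial_characters G. irr_coeff G \<theta> \<phi> > 0 \<and> irr_coeff G \<theta> \<psi> = 0))"
    using const by (intro ball_cong imp_cong bex_cong refl) simp
  finally show ?thesis .
qed

section \<open>Monomials as exponent vectors, and their divisibility by a variable\<close>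

lemma prod_single_one:
  "(\<Prod>i\<in>A. Poly_Mapping.single (f i) 1) =
    (Poly_Mapping.single (\<Sum>i\<in>A. f i) 1 :: ('a::comm_monoid_add \<Rightarrow>\<^sub>0 'k::comm_semiring_1))"
  by (induction A rule: infinite_finite_induct) (auto simp: mult_single)

lemma Var_power: "Var j ^ a = (Poly_Mapping.single (Poly_Mapping.single j a) 1 :: 'k::field mpoly)"
  by (induction a) (auto simp: Var_def mult_single simp flip: single_add)

lemma Var_dvd_single:
  "(Var j :: 'k::field mpoly) dvd Poly_Mapping.single m 1 \<longleftrightarrow> Poly_Mapping.lookup m j > 0"
proof
  assume "(Var j :: 'k mpoly) dvd Poly_Mapping.single m 1"
  then obtain q :: "'k mpoly" where q: "Poly_Mapping.single m 1 = Var j * q" by (auto elim: dvdE)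
  have "m \<in> Poly_Mapping.keys (Poly_Mapping.single m (1 :: 'k))" by simp
  \<comment> \<open>An exponent of a product is a sum of exponents of the factors, and
    \<open>Var j\<close> has only the exponent \<open>single j 1\<close>.\<close>
  then have "m \<in> {a + b | a b. a \<in> Poly_Mapping.keys (Var j :: 'k mpoly) \<and> b \<in> Poly_Mapping.keys q}"
    unfolding q using keys_mult by blast
  then show "Poly_Mapping.lookup m j > 0" by (auto simp: Var_def lookup_add)
next
  assume "Poly_Mapping.lookup m j > 0"
  \<comment> \<open>Subtraction of exponents is truncated; it is exact here because the exponent at
    \<open>j\<close> is positive.\<close>
  then have "m = Poly_Mapping.single j 1 + (m - Poly_Mapping.single j 1)"
    by (intro poly_mapping_eqI) (auto simp: lookup_add lookup_minus lookup_single when_def)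
  then have "Poly_Mapping.single m (1 :: 'k) = Var j * Poly_Mapping.single (m - Poly_Mapping.single j 1) 1"
    by (simp add: Var_def mult_single)
  then show "(Var j :: 'k mpoly) dvd Poly_Mapping.single m 1" by simp
qed

lemma inj_Var: "inj (Var :: nat \<Rightarrow> 'k::field mpoly)"
proof (rule injI)
  fix i j assume "(Var i :: 'k mpoly) = Var j"
  then have "(Var i :: 'k mpoly) dvd Poly_Mapping.single (Poly_Mapping.single j 1) 1" by (simp add: Var_def)
  then show "i = j" unfolding Var_dvd_single by (simp add: lookup_single when_def split: if_splits)
qed

text \<open>The product is again a single monomial, whose exponent at \<open>j\<close> is the sum of
  the coefficients of \<open>\<chi> j\<close>; a sum of naturals is positive exactly when some
  summand is. Singletons give condition (2), general \<open>I\<close> condition (3).\<close>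

lemma Var_dvd_prod_character_monomial:
  assumes "finite I" "j \<in> {1..r}"
  shows "(Var j :: 'k::field mpoly) dvd (\<Prod>i\<in>I. character_monomial G r \<chi> (\<theta> i)) \<longleftrightarrow>
    (\<exists>i\<in>I. irr_coeff G (\<theta> i) (\<chi> j) > 0)"
proof -
  have "(\<Prod>i\<in>I. character_monomial G r \<chi> (\<theta> i)) = (Poly_Mapping.single
      (\<Sum>i\<in>I. \<Sum>l\<in>{1..r}. Poly_Mapping.single l (irr_coeff G (\<theta> i) (\<chi> l))) 1 :: 'k mpoly)"
    by (simp add: character_monomial_def Var_power prod_single_one)
  moreover have "Poly_Mapping.lookup
      (\<Sum>i\<in>I. \<Sum>l\<in>{1..r}. Poly_Mapping.single l (irr_coeff G (\<theta> i) (\<chi> l))) j =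
      (\<Sum>i\<in>I. irr_coeff G (\<theta> i) (\<chi> j))"
    using assms by (simp add: lookup_sum lookup_single when_def)
  ultimately show ?thesis using assms by (simp add: Var_dvd_single sum_nonneg_eq_0_iff flip: neq0_conv)
qed

theorem proposition2p7:
  fixes G :: "('g, 'm) monoid_scheme"
    and \<chi> \<sigma> :: "nat \<Rightarrow> 'g \<Rightarrow> complex"
    and r p :: nat
    and u :: "nat \<Rightarrow> 'k::field mpoly"
    and R_G :: "'k mpoly set"
  assumes "group G" and "finite (carrier G)"
    and "bij_betw \<chi> {1..r} (Irr G)"
    and "inj_on \<sigma> {1..p}"
    and "is_hilbert_basis (monomial_monoid G) (\<sigma> ` {1..p})"
    and "\<And>i. i \<in> {1..p} \<Longrightarrow> u i = character_monomial G r \<chi> (\<sigma> i)"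
    and "R_G = generated_algebra (u ` {1..p})"
  shows "(almost_monomial G \<longleftrightarrow>
            (\<forall>j \<in> {1..r}. \<forall>k \<in> {1..r}. j \<noteq> k \<longrightarrow>
               (\<exists>i \<in> {1..p}. Var j dvd u i \<and> \<not> Var k dvd u i)))
       \<and> (almost_monomial G \<longleftrightarrow>
            (\<forall>k \<in> {1..r}. \<exists>I. I \<subseteq> {1..p} \<and>
               supp r (\<Prod>i\<in>I. u i) = Var ` ({1..r} - {k})))"
proof -
  let ?c = "\<lambda>i j. irr_coeff G (\<sigma> i) (\<chi> j)"
  have finI: "finite (Irr G)" using bij_betw_finite[OF assms(3)] by simp
  note G = assms(1,2) finI
  have Irr: "Irr G = \<chi> ` {1..r}" and inj: "inj_on \<chi> {1..r}"
    using assms(3) by (auto simp: bij_betw_def)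
  have gen: "generated_submonoid (\<sigma> ` {1..p}) = generated_submonoid (monomial_characters G)"
    using assms(5) by (simp add: is_hilbert_basis_def monomial_monoid_def)
  have comb: "\<theta> \<in> range (irr_combination G)" if "\<theta> \<in> generated_submonoid (monomial_characters G)" for \<theta>
    using that
  proof induction
    case zero
    show ?case using irr_combination_zero[symmetric] by (rule range_eqI[of _ "irr_combination G"])
  next
    case (base \<theta>)
    then show ?case using monomial_character_irr_combination[OF G] by blast
  next
    case (add \<theta> \<eta>)
    then obtain a b where "\<theta> = irr_combination G a" "\<eta> = irr_combination G b" by blast
    then have "(\<lambda>g. \<theta> g + \<eta> g) = irr_combination G (\<lambda>\<chi>. a \<chi> + b \<chi>)" by (simp only: irr_combination_add)
    then show ?case by (rule range_eqI[of _ "irr_combination G"])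
  qed
  have \<sigma>: "\<sigma> ` {1..p} \<subseteq> range (irr_combination G)"
  proof
    fix \<theta> assume "\<theta> \<in> \<sigma> ` {1..p}"
    then show "\<theta> \<in> range (irr_combination G)"
      using comb generated_submonoid.base[of \<theta> "\<sigma> ` {1..p}"] unfolding gen by simp
  qed
  have dvd: "Var j dvd (\<Prod>i\<in>I. u i) \<longleftrightarrow> (\<exists>i\<in>I. ?c i j > 0)" if I: "I \<subseteq> {1..p}" and j: "j \<in> {1..r}" for I j
  proof -
    have "(\<Prod>i\<in>I. u i) = (\<Prod>i\<in>I. character_monomial G r \<chi> (\<sigma> i))"
      using I assms(6) by (intro prod.cong) auto
    then show ?thesis using Var_dvd_prod_character_monomial[OF finite_subset[OF I] j] by simp
  qed
  have dvd1: "Var j dvd u i \<longleftrightarrow> ?c i j > 0" if "i \<in> {1..p}" "j \<in> {1..r}" for i j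
    using dvd[of "{i}" j] that by simp
  have one: "almost_monomial G \<longleftrightarrow>
      (\<forall>j \<in> {1..r}. \<forall>k \<in> {1..r}. j \<noteq> k \<longrightarrow> (\<exists>i \<in> {1..p}. ?c i j > 0 \<and> ?c i k = 0))" (is "_ \<longleftrightarrow> ?two")
  proof -
    have "almost_monomial G \<longleftrightarrow>
        (\<forall>\<phi> \<in> Irr G. \<forall>\<psi> \<in> Irr G. \<phi> \<noteq> \<psi> \<longrightarrow>
          (\<exists>\<theta> \<in> \<sigma> ` {1..p}. irr_coeff G \<theta> \<phi> > 0 \<and> irr_coeff G \<theta> \<psi> = 0))"
      unfolding almost_monomial_iff_irr_coeff[OF G]
      \<comment> \<open>Applied to two generating sets of one monoid: a separating element of either
        set amounts to one in the monoid, and \<open>gen\<close> identifies the two monoids.\<close>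
      using separation_generated_submonoid[OF G _ _ \<sigma>]
        separation_generated_submonoid[OF G _ _ monomial_character_irr_combination[OF G]]
      by (intro ball_cong imp_cong refl) (simp only: gen)
    also have "\<dots> \<longleftrightarrow> ?two" unfolding Irr using inj by (auto simp: inj_on_eq_iff)
    finally show ?thesis .
  qed
  have supp: "supp r (\<Prod>i\<in>I. u i) = Var ` {j \<in> {1..r}. \<exists>i\<in>I. ?c i j > 0}" if "I \<subseteq> {1..p}" for I
    unfolding supp_def using dvd[OF that] by blast
  \<comment> \<open>With coefficients in place of polynomials, the support of a product is the union
    of the supports over \<open>I\<close>; a member of \<open>I\<close> covering \<open>j\<close>
    must avoid \<open>k\<close>, as the union does.\<close>
  have three: "?two \<longleftrightarrow>
      (\<forall>k \<in> {1..r}. \<exists>I. I \<subseteq> {1..p} \<and> {j \<in> {1..r}. \<exists>i\<in>I. ?c i j > 0} = {1..r} - {k})"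
  proof (intro iffI ballI)
    fix k assume two: ?two and k: "k \<in> {1..r}"
    show "\<exists>I. I \<subseteq> {1..p} \<and> {j \<in> {1..r}. \<exists>i\<in>I. ?c i j > 0} = {1..r} - {k}"
    proof (intro exI conjI)
      show "{j \<in> {1..r}. \<exists>i\<in>{i \<in> {1..p}. ?c i k = 0}. ?c i j > 0} = {1..r} - {k}"
      proof (intro equalityI subsetI)
        fix j assume "j \<in> {1..r} - {k}"
        then have "\<exists>i \<in> {1..p}. ?c i j > 0 \<and> ?c i k = 0" using two k by blast
        then show "j \<in> {j \<in> {1..r}. \<exists>i\<in>{i \<in> {1..p}. ?c i k = 0}. ?c i j > 0}"
          using \<open>j \<in> {1..r} - {k}\<close> by blast
      qed auto
    qed auto
  next
    fix j k assume three: "\<forall>k \<in> {1..r}. \<exists>I. I \<subseteq> {1..p} \<and> {j \<in> {1..r}. \<exists>i\<in>I. ?c i j > 0} = {1..r} - {k}"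
      and j: "j \<in> {1..r}" and k: "k \<in> {1..r}"
    then obtain I where I: "I \<subseteq> {1..p}" "{j \<in> {1..r}. \<exists>i\<in>I. ?c i j > 0} = {1..r} - {k}" by blast
    show "j \<noteq> k \<longrightarrow> (\<exists>i \<in> {1..p}. ?c i j > 0 \<and> ?c i k = 0)"
    proof
      assume "j \<noteq> k"
      then have "j \<in> {j \<in> {1..r}. \<exists>i\<in>I. ?c i j > 0}" "k \<notin> {j \<in> {1..r}. \<exists>i\<in>I. ?c i j > 0}"
        using I(2) j by simp_all
      then obtain i where "i \<in> I" "?c i j > 0" "\<not> ?c i k > 0" using k by blast
      then show "\<exists>i \<in> {1..p}. ?c i j > 0 \<and> ?c i k = 0" using I(1) by auto
    qed
  qed
  have "(\<forall>j \<in> {1..r}. \<forall>k \<in> {1..r}. j \<noteq> k \<longrightarrow> (\<exists>i \<in> {1..p}. Var j dvd u i \<and> \<not> Var k dvd u i)) \<longleftrightarrow> ?two"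
    by (intro ball_cong imp_cong bex_cong refl) (simp add: dvd1)
  \<comment> \<open>Injectivity of \<open>Var\<close> turns equality of sets of variables into
    equality of index sets.\<close>
  moreover have "(\<forall>k \<in> {1..r}. \<exists>I. I \<subseteq> {1..p} \<and> supp r (\<Prod>i\<in>I. u i) = Var ` ({1..r} - {k})) \<longleftrightarrow> ?two"
    unfolding three
    by (intro ball_cong ex_cong1 conj_cong refl) (simp only: supp inj_image_eq_iff[OF inj_Var])
  ultimately show ?thesis using one by simp
qed

end
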